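(* Let $\varphi$ be a Musielak–Orlicz function of uniformly lower type $p$ for some $p\in(0,\infty)$. If $\varphi\in\mathbb S^-$ and the stochastic basis is regular, then for every $r\in(0,1]$, $H^M_\varphi(\Omega)=H^{\varphi,\infty,M}_{\mathrm{at},r}(\Omega)$ and $H^S_\varphi(\Omega)=H^{\varphi,\infty,S}_{\mathrm{at},r}(\Omega)$ with equivalent quasi-norms.
   Context: Let $(\Omega,\mathcal F,\mathbb P)$ be a probability space, $(\mathcal F_n)_{n\in\mathbb Z_+}$ a nondecreasing sequence of sub-$\sigma$-algebras, $\mathbb E_n$ the conditional expectations. A Musielak–Orlicz function is $\varphi:\Omega\times[0,\infty)\to[0,\infty)$ with $\varphi(x,\cdot)$ nondecreasing, $\varphi(x,0)=0$, $\lim_{t\to\infty}\varphi(x,t)=\infty$ for each $x$, $\varphi(\cdot,t)$ measurable, positive and integrable for each $t$; $\varphi_n(\cdot,t):=\mathbb E_n\varphi(\cdot,t)$; $\|f\|_{L^\varphi(\Omega)}:=\inf\{\lambda>0:\int_\Omega\varphi(x,|f|/\lambda)\,d\mathbb P\le1\}$. Uniformly lower type $p$: $\varphi(x,st)\le Cs^p\varphi(x,t)$ for all $x$, $t\ge0$, $s\in(0,1)$. $\varphi\in\mathbb S^-$: there is $K$ with $K^{-1}\varphi_{n-1}(x,t)\le\varphi_n(x,t)$ for all $t\ge0$, $n\ge1$, a.e. $x$. Regular: there is $R$ with $f_n\le Rf_{n-1}$ for all $n\ge1$ and every nonnegative martingale. $\mathcal M$: martingales $f=(f_n)$ with $f_0=0$;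 $d_nf=f_n-f_{n-1}$; $S(f)=(\sum_{i\ge1}|d_if|^2)^{1/2}$; $M(f)=\sup_n|f_n|$; $H^M_\varphi(\Omega)=\{f\in\mathcal M:\|M(f)\|_{L^\varphi}<\infty\}$, $H^S_\varphi(\Omega)=\{f\in\mathcal M:\|S(f)\|_{L^\varphi}<\infty\}$ with these quasi-norms. For a stopping time $\nu$, $B_\nu=\{\nu<\infty\}$. For $T\in\{S,M\}$, a measurable $a$ is a $(\varphi,\infty)_T$-atom if there is a stopping time $\nu$ with (i) $\mathbb E_na=0$ whenever $\nu\ge n$, (ii) $\|T(a)\|_{L^\infty(B_\nu)}\le\|\mathbf 1_{B_\nu}\|_{L^\varphi}^{-1}$ (computed for the martingale $(\mathbb E_na)$). For $r>0$, $H^{\varphi,\infty,T}_{\mathrm{at},r}(\Omega)$ is the set of $f\in\mathcal M$ with $f_n=\sum_{k\in\mathbb Z}\mu^k\mathbb E_na^k$ for all $n$, where $\mu^k\ge0$ and $a^k$ are $(\varphi,\infty)_T$-atoms with stopping times $\nu^k$, such that $\|\{\sum_k[\mu^k\mathbf 1_{B_{\nu^k}}/\|\mathbf 1_{B_{\nu^k}}\|_{L^\varphi}]^r\}^{1/r}\|_{L^\varphi}<\infty$; the quasi-norm is the infimum of this over all decompositions. *)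

theory Defs
  imports "HOL-Probability.Probability"
begin

definition filtr :: "'a measure \<Rightarrow> (nat \<Rightarrow> 'a measure) \<Rightarrow> bool" where
  "filtr M F \<longleftrightarrow> (\<forall>n. subalgebra M (F n)) \<and> (\<forall>n. sets (F n) \<subseteq> sets (F (Suc n)))"

abbreviation condE :: "'a measure \<Rightarrow> (nat \<Rightarrow> 'a measure) \<Rightarrow> nat \<Rightarrow> ('a \<Rightarrow> real) \<Rightarrow> 'a \<Rightarrow> real" where
  "condE M F n g \<equiv> real_cond_exp M (F n) g"

definition martingale :: "'a measure \<Rightarrow> (nat \<Rightarrow> 'a measure) \<Rightarrow> (nat \<Rightarrow> 'a \<Rightarrow> real) \<Rightarrow> bool" where
  "martingale M F f \<longleftrightarrow>
     (\<forall>n. integrable M (f n) \<and> f n \<in> borel_measurable (F n) \<and>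
          (AE x in M. condE M F n (f (Suc n)) x = f n x))"

definition mart0 :: "'a measure \<Rightarrow> (nat \<Rightarrow> 'a measure) \<Rightarrow> (nat \<Rightarrow> 'a \<Rightarrow> real) set" where
  "mart0 M F = {f. martingale M F f \<and> (AE x in M. f 0 x = 0)}"

definition regular :: "'a measure \<Rightarrow> (nat \<Rightarrow> 'a measure) \<Rightarrow> bool" where
  "regular M F \<longleftrightarrow> (\<exists>R. \<forall>f. martingale M F f \<and> (\<forall>n. AE x in M. 0 \<le> f n x) \<longrightarrow>
       (\<forall>n\<ge>1. AE x in M. f n x \<le> R * f (n - 1) x))"

definition stopping :: "'a measure \<Rightarrow> (nat \<Rightarrow> 'a measure) \<Rightarrow> ('a \<Rightarrow> enat) \<Rightarrow> bool" where
  "stopping M F \<nu> \<longleftrightarrow> (\<forall>n. {x \<in> space M. \<nu> x = enat n} \<in> sets (F n))"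

definition Bset :: "'a measure \<Rightarrow> ('a \<Rightarrow> enat) \<Rightarrow> 'a set" where
  "Bset M \<nu> = {x \<in> space M. \<nu> x < \<infinity>}"

text \<open>Only the values of \<phi> x t for t \<ge> 0 matter.\<close>
definition MO_function :: "'a measure \<Rightarrow> ('a \<Rightarrow> real \<Rightarrow> real) \<Rightarrow> bool" where
  "MO_function M \<phi> \<longleftrightarrow>
     (\<forall>x\<in>space M. \<forall>s t. 0 \<le> s \<longrightarrow> s \<le> t \<longrightarrow> \<phi> x s \<le> \<phi> x t) \<and>
     (\<forall>x\<in>space M. \<phi> x 0 = 0) \<and>
     (\<forall>x\<in>space M. filterlim (\<phi> x) at_top at_top) \<and>
     (\<forall>t\<ge>0. (\<lambda>x. \<phi> x t) \<in> borel_measurable M \<and> integrable M (\<lambda>x. \<phi> x t)) \<and>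
     (\<forall>t>0. \<forall>x\<in>space M. 0 < \<phi> x t)"

definition unif_lower_type :: "'a measure \<Rightarrow> ('a \<Rightarrow> real \<Rightarrow> real) \<Rightarrow> real \<Rightarrow> bool" where
  "unif_lower_type M \<phi> p \<longleftrightarrow> (\<exists>C. \<forall>x\<in>space M. \<forall>t\<ge>0. \<forall>s. 0 < s \<and> s < 1 \<longrightarrow>
       \<phi> x (s * t) \<le> C * s powr p * \<phi> x t)"

definition S_minus :: "'a measure \<Rightarrow> (nat \<Rightarrow> 'a measure) \<Rightarrow> ('a \<Rightarrow> real \<Rightarrow> real) \<Rightarrow> bool" where
  "S_minus M F \<phi> \<longleftrightarrow> (\<exists>K>0. \<forall>t\<ge>0. \<forall>n\<ge>1. AE x in M.
       inverse K * condE M F (n - 1) (\<lambda>y. \<phi> y t) x \<le> condE M F n (\<lambda>y. \<phi> y t) x)"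

definition phiE :: "('a \<Rightarrow> real \<Rightarrow> real) \<Rightarrow> 'a \<Rightarrow> ennreal \<Rightarrow> ennreal" where
  "phiE \<phi> x u = (if u = \<top> then \<top> else ennreal (\<phi> x (enn2real u)))"

text \<open>Luxemburg quasi-norm (value \<top> when no admissible \<lambda> exists).\<close>
definition lux :: "'a measure \<Rightarrow> ('a \<Rightarrow> real \<Rightarrow> real) \<Rightarrow> ('a \<Rightarrow> ennreal) \<Rightarrow> ennreal" where
  "lux M \<phi> g = Inf {ennreal l | l. 0 < l \<and> (\<integral>\<^sup>+ x. phiE \<phi> x (g x / ennreal l) \<partial>M) \<le> 1}"

definition epow :: "ennreal \<Rightarrow> real \<Rightarrow> ennreal" where
  "epow u r = (if u = \<top> then \<top> else ennreal (enn2real u powr r))"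

definition maxf :: "(nat \<Rightarrow> 'a \<Rightarrow> real) \<Rightarrow> 'a \<Rightarrow> ennreal" where
  "maxf f x = (SUP n. ennreal \<bar>f n x\<bar>)"

definition sqf :: "(nat \<Rightarrow> 'a \<Rightarrow> real) \<Rightarrow> 'a \<Rightarrow> ennreal" where
  "sqf f x = epow (\<Sum>i. ennreal ((f (Suc i) x - f i x)\<^sup>2)) (1/2)"

definition Hsp :: "'a measure \<Rightarrow> (nat \<Rightarrow> 'a measure) \<Rightarrow> ('a \<Rightarrow> real \<Rightarrow> real)
    \<Rightarrow> ((nat \<Rightarrow> 'a \<Rightarrow> real) \<Rightarrow> 'a \<Rightarrow> ennreal) \<Rightarrow> (nat \<Rightarrow> 'a \<Rightarrow> real) set" where
  "Hsp M F \<phi> T = {f \<in> mart0 M F. lux M \<phi> (T f) < \<top>}"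

definition atom :: "'a measure \<Rightarrow> (nat \<Rightarrow> 'a measure) \<Rightarrow> ('a \<Rightarrow> real \<Rightarrow> real)
    \<Rightarrow> ((nat \<Rightarrow> 'a \<Rightarrow> real) \<Rightarrow> 'a \<Rightarrow> ennreal) \<Rightarrow> ('a \<Rightarrow> real) \<Rightarrow> ('a \<Rightarrow> enat) \<Rightarrow> bool" where
  "atom M F \<phi> T a \<nu> \<longleftrightarrow>
     integrable M a \<and> stopping M F \<nu> \<and>
     (\<forall>n. AE x in M. enat n \<le> \<nu> x \<longrightarrow> condE M F n a x = 0) \<and>
     (AE x in M. x \<in> Bset M \<nu> \<longrightarrow>
        T (\<lambda>n. condE M F n a) x \<le> inverse (lux M \<phi> (indicator (Bset M \<nu>))))"

definition atdec :: "'a measure \<Rightarrow> (nat \<Rightarrow> 'a measure) \<Rightarrow> ('a \<Rightarrow> real \<Rightarrow> real)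
    \<Rightarrow> ((nat \<Rightarrow> 'a \<Rightarrow> real) \<Rightarrow> 'a \<Rightarrow> ennreal) \<Rightarrow> (nat \<Rightarrow> 'a \<Rightarrow> real)
    \<Rightarrow> (int \<Rightarrow> real) \<Rightarrow> (int \<Rightarrow> 'a \<Rightarrow> real) \<Rightarrow> (int \<Rightarrow> 'a \<Rightarrow> enat) \<Rightarrow> bool" where
  "atdec M F \<phi> T f \<mu> a \<nu> \<longleftrightarrow>
     (\<forall>k. 0 \<le> \<mu> k \<and> atom M F \<phi> T (a k) (\<nu> k)) \<and>
     (\<forall>n. AE x in M. ((\<lambda>k. \<mu> k * condE M F n (a k) x) has_sum f n x) UNIV)"

definition atq :: "'a measure \<Rightarrow> ('a \<Rightarrow> real \<Rightarrow> real) \<Rightarrow> real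
    \<Rightarrow> (int \<Rightarrow> real) \<Rightarrow> (int \<Rightarrow> 'a \<Rightarrow> enat) \<Rightarrow> ennreal" where
  "atq M \<phi> r \<mu> \<nu> = lux M \<phi> (\<lambda>x. epow (\<Sum>\<^sub>\<infinity>k\<in>UNIV.
       epow (ennreal (\<mu> k) * indicator (Bset M (\<nu> k)) x / lux M \<phi> (indicator (Bset M (\<nu> k)))) r)
     (1 / r))"

definition Hat :: "'a measure \<Rightarrow> (nat \<Rightarrow> 'a measure) \<Rightarrow> ('a \<Rightarrow> real \<Rightarrow> real)
    \<Rightarrow> ((nat \<Rightarrow> 'a \<Rightarrow> real) \<Rightarrow> 'a \<Rightarrow> ennreal) \<Rightarrow> real \<Rightarrow> (nat \<Rightarrow> 'a \<Rightarrow> real) set" where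
  "Hat M F \<phi> T r = {f \<in> mart0 M F. \<exists>\<mu> a \<nu>. atdec M F \<phi> T f \<mu> a \<nu> \<and> atq M \<phi> r \<mu> \<nu> < \<top>}"

definition atnorm :: "'a measure \<Rightarrow> (nat \<Rightarrow> 'a measure) \<Rightarrow> ('a \<Rightarrow> real \<Rightarrow> real)
    \<Rightarrow> ((nat \<Rightarrow> 'a \<Rightarrow> real) \<Rightarrow> 'a \<Rightarrow> ennreal) \<Rightarrow> real \<Rightarrow> (nat \<Rightarrow> 'a \<Rightarrow> real) \<Rightarrow> ennreal" where
  "atnorm M F \<phi> T r f = Inf {atq M \<phi> r \<mu> \<nu> | \<mu> a \<nu>. atdec M F \<phi> T f \<mu> a \<nu>}"

end

theory Submission
  imports Defs
begin

text \<open>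
  For \<open>r \<le> 1\<close> an atomic decomposition bounds \<open>T f\<close> pointwise by \<open>\<Sum> \<mu>\<^sup>k T (a\<^sup>k)\<close>, hence by the function
  whose Luxemburg norm defines the atomic quasi-norm.

  Conversely, let \<open>T\<^sub>n f\<close> be the truncation of \<open>T f\<close> at time \<open>n\<close> and let \<open>\<nu>\<^sup>k\<close> be the first \<open>n\<close> at which
  the conditional probability of \<open>T\<^sub>n\<^sub>+\<^sub>1 f > 2\<^sup>k\<close> given \<open>F n\<close> is at least \<open>1 / R\<close>. Regularity of the stochastic
  basis shows that \<open>T\<^sub>n f \<le> 2\<^sup>k\<close> as long as \<open>n \<le> \<nu>\<^sup>k\<close>, so the differences \<open>f\<close> stopped at \<open>\<nu>\<^sup>k\<^sup>+\<^sup>1\<close> minus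
  \<open>f\<close> stopped at \<open>\<nu>\<^sup>k\<close> are bounded in \<open>L\<^sup>2\<close>; they are closed by integrable functions, which are the
  multiples of atoms sought, and they telescope to \<open>f\<close>. By \<open>S_minus\<close> the weight \<open>\<phi>(\<cdot>, t)\<close> of
  \<open>\<nu>\<^sup>k < \<infinity>\<close> is at most \<open>R K\<close> times that of \<open>T f > 2\<^sup>k\<close>, and the lower type turns the resulting sum
  over \<open>k\<close> into a geometric series dominated by \<open>\<phi>(x, T f(x))\<close>. The integrand \<open>\<phi>(x, T f(x))\<close> itself need
  not be measurable; only lower bounds of its integral by integrals of measurable functions are used.
\<close>

section \<open>Martingales on a filtered probability space\<close>

locale filtered_prob = prob_space M for M :: "'a measure" +
  fixes F :: "nat \<Rightarrow> 'a measure"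
  assumes filtration: "filtr M F"
begin

lemma subalg: "subalgebra M (F n)"
  using filtration by (auto simp: filtr_def)

lemma space_F: "space (F n) = space M"
  using subalg[of n] by (auto simp: subalgebra_def)

lemma sets_F_M: "A \<in> sets (F n) \<Longrightarrow> A \<in> sets M"
  using subalg[of n] by (auto simp: subalgebra_def)

lemma sets_F_mono:
  assumes "m \<le> n"
  shows "sets (F m) \<subseteq> sets (F n)"
  using assms
proof (induction n rule: dec_induct)
  case (step n)
  moreover have "sets (F n) \<subseteq> sets (F (Suc n))"
    using filtration by (simp add: filtr_def)
  ultimately show ?case by (rule_tac order_trans)
qed simp

lemma subalg_mono: "m \<le> n \<Longrightarrow> subalgebra (F n) (F m)"
  using sets_F_mono[of m n] by (auto simp: subalgebra_def space_F)

lemma measurable_F_mono: "f \<in> measurable (F m) N \<Longrightarrow> m \<le> n \<Longrightarrow> f \<in> measurable (F n) N"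
  using measurable_from_subalg[OF subalg_mono] by blast

sublocale CE: sigma_finite_subalgebra M "F n" for n
  by (intro finite_measure_subalgebra_is_sigma_finite finite_measure_subalgebra.intro
      finite_measure_subalgebra_axioms.intro subalg finite_measure_axioms)

lemma martingaleD:
  assumes "martingale M F g"
  shows "integrable M (g n)" "g n \<in> borel_measurable (F n)" "g n \<in> borel_measurable M"
    "AE x in M. condE M F n (g (Suc n)) x = g n x"
  using assms by (auto simp: martingale_def)

lemma martingale_condE:
  assumes g: "martingale M F g" and "m \<le> n"
  shows "AE x in M. condE M F m (g n) x = g m x"
  using \<open>m \<le> n\<close>
proof (induction n rule: dec_induct)
  case base
  show ?case using martingaleD[OF g] by (intro CE.real_cond_exp_F_meas) auto
next
  case (step n)
  have "AE x in M. condE M F m (condE M F n (g (Suc n))) x = condE M F m (g (Suc n)) x"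
    using step(1) by (intro CE.real_cond_exp_nested_subalg subalg subalg_mono martingaleD[OF g])
  moreover have "AE x in M. condE M F m (condE M F n (g (Suc n))) x = condE M F m (g n) x"
    by (intro CE.real_cond_exp_cong martingaleD[OF g] borel_measurable_cond_exp2)
  ultimately show ?case using step.IH by eventually_elim simp
qed

lemma martingale_closed:
  assumes "integrable M a"
  shows "martingale M F (\<lambda>n. condE M F n a)"
  unfolding martingale_def
  using assms by (auto intro!: CE.real_cond_exp_int CE.real_cond_exp_nested_subalg subalg subalg_mono)

section \<open>Square-integrable martingales and their closure\<close>

lemma integrable_mult_squares:
  fixes f g :: "'a \<Rightarrow> real"
  assumes [measurable]: "f \<in> borel_measurable M" "g \<in> borel_measurable M"
    and "integrable M (\<lambda>x. (f x)\<^sup>2)" "integrable M (\<lambda>x. (g x)\<^sup>2)"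
  shows "integrable M (\<lambda>x. f x * g x)"
proof (rule Bochner_Integration.integrable_bound)
  show "integrable M (\<lambda>x. (f x)\<^sup>2 + (g x)\<^sup>2)" using assms by auto
  have "\<bar>f x * g x\<bar> \<le> (f x)\<^sup>2 + (g x)\<^sup>2" for x
  proof -
    have "0 \<le> (\<bar>f x\<bar> - \<bar>g x\<bar>)\<^sup>2 + (f x)\<^sup>2 + (g x)\<^sup>2" by simp
    then show ?thesis by (simp add: power2_eq_square algebra_simps abs_mult)
  qed
  then show "AE x in M. norm (f x * g x) \<le> norm ((f x)\<^sup>2 + (g x)\<^sup>2)" by auto
qed auto

text \<open>Since g_m is \<open>F m\<close>-measurable, conditioning on \<open>F m\<close> turns the
  cross term E(g_m g_n) into E(g_m^2).\<close>

lemma martingale_orthogonal: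
  assumes g: "martingale M F g" and sq: "\<And>n. integrable M (\<lambda>x. (g n x)\<^sup>2)" and "m \<le> n"
  shows "integrable M (\<lambda>x. (g n x - g m x)\<^sup>2)"
    "(\<integral>x. (g n x - g m x)\<^sup>2 \<partial>M) = (\<integral>x. (g n x)\<^sup>2 \<partial>M) - (\<integral>x. (g m x)\<^sup>2 \<partial>M)"
proof -
  have [measurable]: "g n \<in> borel_measurable M" for n by (rule martingaleD[OF g])
  have int: "integrable M (\<lambda>x. g m x * g n x)" by (intro integrable_mult_squares sq) auto
  have eq: "(g n x - g m x)\<^sup>2 = (g n x)\<^sup>2 + (g m x)\<^sup>2 - 2 * (g m x * g n x)" for x
    by (simp add: power2_eq_square algebra_simps)
  show "integrable M (\<lambda>x. (g n x - g m x)\<^sup>2)"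
    unfolding eq using sq int by auto
  have "(\<integral>x. g m x * g n x \<partial>M) = (\<integral>x. g m x * condE M F m (g n) x \<partial>M)"
    by (rule CE.real_cond_exp_intg(2)[symmetric, OF int]) (auto intro: martingaleD[OF g])
  also have "\<dots> = (\<integral>x. (g m x)\<^sup>2 \<partial>M)"
    using martingale_condE[OF g \<open>m \<le> n\<close>]
    by (intro integral_cong_AE) (auto simp: power2_eq_square)
  finally show "(\<integral>x. (g n x - g m x)\<^sup>2 \<partial>M) = (\<integral>x. (g n x)\<^sup>2 \<partial>M) - (\<integral>x. (g m x)\<^sup>2 \<partial>M)"
    unfolding eq using sq int by (simp add: integral_add integral_diff)
qed

text \<open>Orthogonality of the increments is what turns a bound on the square function into a
  bound on second moments.\<close>

lemma martingale_square_sum: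
  assumes g: "martingale M F g" and sq: "\<And>n. integrable M (\<lambda>x. (g n x)\<^sup>2)"
  shows "(\<integral>x. (g n x)\<^sup>2 \<partial>M) = (\<integral>x. (g 0 x)\<^sup>2 \<partial>M) + (\<integral>x. (\<Sum>i<n. (g (Suc i) x - g i x)\<^sup>2) \<partial>M)"
proof -
  have "(\<integral>x. (\<Sum>i<n. (g (Suc i) x - g i x)\<^sup>2) \<partial>M) = (\<Sum>i<n. \<integral>x. (g (Suc i) x - g i x)\<^sup>2 \<partial>M)"
    by (intro Bochner_Integration.integral_sum martingale_orthogonal[OF g sq]) auto
  also have "\<dots> = (\<Sum>i<n. (\<integral>x. (g (Suc i) x)\<^sup>2 \<partial>M) - (\<integral>x. (g i x)\<^sup>2 \<partial>M))"
    by (intro sum.cong martingale_orthogonal[OF g sq]) auto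
  also have "\<dots> = (\<integral>x. (g n x)\<^sup>2 \<partial>M) - (\<integral>x. (g 0 x)\<^sup>2 \<partial>M)"
    by (rule sum_lessThan_telescope)
  finally show ?thesis by simp
qed

text \<open>The second moments increase to a finite limit, so along a sparse subsequence the
  increments have L^1 norms at most 2^-j. The telescoping series defines \<open>a\<close>; tested on
  a set of \<open>F n\<close>, its partial sums are eventually constant.\<close>

lemma martingale_L2_bounded_closed:
  assumes g: "martingale M F g" and sq: "\<And>n. integrable M (\<lambda>x. (g n x)\<^sup>2)"
    and bnd: "\<And>n. (\<integral>x. (g n x)\<^sup>2 \<partial>M) \<le> B"
  obtains a where "integrable M a" "\<And>n. AE x in M. condE M F n a x = g n x"
proof -
  define s where "s n = (\<integral>x. (g n x)\<^sup>2 \<partial>M)" for n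
  have [measurable]: "g n \<in> borel_measurable M" for n by (rule martingaleD[OF g])
  have diff: "(\<integral>x. (g n x - g m x)\<^sup>2 \<partial>M) = s n - s m" if "m \<le> n" for m n
    unfolding s_def by (rule martingale_orthogonal(2)[OF g sq that])
  have "incseq s"
  proof (rule incseq_SucI)
    fix n
    have "0 \<le> (\<integral>x. (g (Suc n) x - g n x)\<^sup>2 \<partial>M)" by simp
    then show "s n \<le> s (Suc n)" using diff[of n "Suc n"] by simp
  qed
  then obtain L where L: "s \<longlonglongrightarrow> L" "\<forall>i. s i \<le> L"
    using incseq_convergent[of s B] bnd by (metis s_def)
  have "\<exists>N. L - (1/4)^j < s N" for j
  proof -
    have "eventually (\<lambda>n. L - (1/4)^j < s n) sequentially"
      using L(1) by (rule order_tendstoD) simp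
    then show ?thesis by (auto simp: eventually_sequentially)
  qed
  then obtain N0 where N0: "\<And>j. L - (1/4)^j < s (N0 j)" by metis
  \<comment> \<open>This choice gives at once \<open>N0 j \<le> N j\<close>, monotonicity and
    \<open>j \<le> N j\<close>.\<close>
  define N where "N j = (\<Sum>i\<le>j. N0 i) + j" for j
  have N0_le: "N0 j \<le> N j" for j
    unfolding N_def by (rule trans_le_add1, rule member_le_sum) auto
  have N_mono: "N j \<le> N (Suc j)" for j by (simp add: N_def)
  have N_ge: "j \<le> N j" for j by (simp add: N_def)
  define \<Delta> where "\<Delta> j x = g (N (Suc j)) x - g (N j) x" for j x
  have \<Delta>_int: "integrable M (\<Delta> j)" for j
    unfolding \<Delta>_def using martingaleD(1)[OF g] by auto
  have \<Delta>_le: "(\<integral>x. norm (\<Delta> j x) \<partial>M) \<le> (1/2)^j" for j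
  proof -
    have int: "integrable M (\<lambda>x. (\<Delta> j x)\<^sup>2)"
      unfolding \<Delta>_def by (rule martingale_orthogonal(1)[OF g sq N_mono])
    have "(\<integral>x. (\<Delta> j x)\<^sup>2 \<partial>M) = s (N (Suc j)) - s (N j)"
      unfolding \<Delta>_def by (rule diff[OF N_mono])
    also have "\<dots> \<le> (1/4)^j"
      using L(2) N0[of j] incseqD[OF \<open>incseq s\<close> N0_le[of j]] by (smt (verit))
    finally have le: "(\<integral>x. (\<Delta> j x)\<^sup>2 \<partial>M) \<le> (1/4)^j" .
    \<comment> \<open>Young's inequality with weight 2^j: after integration both terms have size
      2^-j, since the second moment is at most 4^-j.\<close>
    have "\<bar>\<Delta> j x\<bar> \<le> (2^j * (\<Delta> j x)\<^sup>2 + (1/2)^j) / 2" for x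
    proof -
      have "0 \<le> (2^j * \<bar>\<Delta> j x\<bar> - 1)\<^sup>2" by simp
      then have "2 * 2^j * \<bar>\<Delta> j x\<bar> \<le> 2^j * (2^j * (\<Delta> j x)\<^sup>2) + 1"
        by (simp add: power2_eq_square algebra_simps)
      then have "2^j * (2 * \<bar>\<Delta> j x\<bar>) \<le> 2^j * (2^j * (\<Delta> j x)\<^sup>2 + (1/2)^j)"
        by (simp add: algebra_simps power_one_over)
      then show ?thesis by (simp add: mult_le_cancel_left_pos)
    qed
    then have "(\<integral>x. norm (\<Delta> j x) \<partial>M) \<le> (\<integral>x. (2^j * (\<Delta> j x)\<^sup>2 + (1/2)^j) / 2 \<partial>M)"
      using int \<Delta>_int by (intro integral_mono) auto
    also have "\<dots> = (2^j * (\<integral>x. (\<Delta> j x)\<^sup>2 \<partial>M) + (1/2)^j) / 2"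
      using int by (simp add: prob_space)
    also have "\<dots> \<le> (2^j * (1/4)^j + (1/2)^j) / 2"
      using le by (intro divide_right_mono add_right_mono mult_left_mono) auto
    also have "2^j * (1/4)^j = ((1/2)^j :: real)" by (simp add: power_mult_distrib[symmetric])
    finally show ?thesis by simp
  qed
  have sum_int: "summable (\<lambda>j. \<integral>x. norm (\<Delta> j x) \<partial>M)"
    by (rule summable_comparison_test'[where g = "\<lambda>j. (1/2)^j" and N = 0]) (use \<Delta>_le in auto)
  have AE_sum: "AE x in M. summable (\<lambda>j. norm (\<Delta> j x))"
  proof -
    have [measurable]: "\<Delta> j \<in> borel_measurable M" for j using \<Delta>_int by auto
    have "(\<integral>\<^sup>+x. (\<Sum>j. ennreal (norm (\<Delta> j x))) \<partial>M) = (\<Sum>j. \<integral>\<^sup>+x. ennreal (norm (\<Delta> j x)) \<partial>M)"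
      by (rule nn_integral_suminf) auto
    also have "\<dots> = (\<Sum>j. ennreal (\<integral>x. norm (\<Delta> j x) \<partial>M))"
      using \<Delta>_int by (intro suminf_cong nn_integral_eq_integral) auto
    also have "\<dots> \<noteq> \<infinity>"
      unfolding infinity_ennreal_def by (rule ennreal_suminf_neq_top[OF sum_int]) (rule integral_nonneg_AE, simp)
    finally have "AE x in M. (\<Sum>j. ennreal (norm (\<Delta> j x))) \<noteq> \<infinity>"
      by (rule nn_integral_PInf_AE[rotated]) measurable
    then show ?thesis
      by eventually_elim (auto intro: summable_suminf_not_top)
  qed
  define a where "a x = g (N 0) x + (\<Sum>j. \<Delta> j x)" for x
  have a_int: "integrable M a"
    unfolding a_def using integrable_suminf[OF \<Delta>_int AE_sum sum_int] martingaleD(1)[OF g] by auto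
  have "AE x in M. condE M F n a x = g n x" for n
  proof (rule CE.real_cond_exp_charact[OF _ a_int])
    fix A assume A: "A \<in> sets (F n)"
    then have [measurable]: "A \<in> sets M" by (rule sets_F_M)
    have intA: "integrable M (\<lambda>x. indicator A x * \<Delta> j x)" for j
      using integrable_mult_indicator[OF _ \<Delta>_int, of A j] by simp
    have sumA: "(\<lambda>j. \<integral>x. indicator A x * \<Delta> j x \<partial>M) sums (\<integral>x. (\<Sum>j. indicator A x * \<Delta> j x) \<partial>M)"
    proof (rule sums_integral[OF intA])
      show "AE x in M. summable (\<lambda>j. norm (indicat_real A x * \<Delta> j x))"
        using AE_sum by eventually_elim (auto split: split_indicator)
      show "summable (\<lambda>j. \<integral>x. norm (indicat_real A x * \<Delta> j x) \<partial>M)"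
      proof (rule summable_comparison_test'[OF sum_int, where N = 0])
        fix j
        have "(\<integral>x. norm (indicat_real A x * \<Delta> j x) \<partial>M) \<le> (\<integral>x. norm (\<Delta> j x) \<partial>M)"
          using intA \<Delta>_int by (intro integral_mono integrable_norm) (auto split: split_indicator)
        then show "norm (\<integral>x. norm (indicat_real A x * \<Delta> j x) \<partial>M) \<le> (\<integral>x. norm (\<Delta> j x) \<partial>M)" by simp
      qed
    qed
    have gA: "integrable M (\<lambda>x. indicator A x * g m x)" for m
      using integrable_mult_indicator[OF _ martingaleD(1)[OF g], of A m] by simp
    have part: "(\<Sum>j<J. \<integral>x. indicator A x * \<Delta> j x \<partial>M)
        = (\<integral>x. indicator A x * g (N J) x \<partial>M) - (\<integral>x. indicator A x * g (N 0) x \<partial>M)" for J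
    proof -
      have "(\<integral>x. indicator A x * \<Delta> j x \<partial>M)
        = (\<integral>x. indicator A x * g (N (Suc j)) x \<partial>M) - (\<integral>x. indicator A x * g (N j) x \<partial>M)" for j
        unfolding \<Delta>_def right_diff_distrib by (rule Bochner_Integration.integral_diff[OF gA gA])
      then show ?thesis by (simp add: sum_lessThan_telescope[of "\<lambda>j. \<integral>x. indicator A x * g (N j) x \<partial>M"])
    qed
    have const: "(\<integral>x. indicator A x * g m x \<partial>M) = (\<integral>x. indicator A x * g n x \<partial>M)" if "n \<le> m" for m
    proof -
      have "(\<integral>x. indicator A x * g m x \<partial>M) = (\<integral>x. indicator A x * condE M F n (g m) x \<partial>M)"
        using A by (intro CE.real_cond_exp_intg(2)[symmetric, OF gA]) auto
      also have "\<dots> = (\<integral>x. indicator A x * g n x \<partial>M)"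
        using martingale_condE[OF g that] by (intro integral_cong_AE) auto
      finally show ?thesis .
    qed
    \<comment> \<open>For \<open>J \<ge> n\<close> also \<open>N J \<ge> n\<close>, and by the
      martingale property the integral over \<open>A\<close> no longer changes.\<close>
    have "(\<lambda>J. \<Sum>j<J. \<integral>x. indicator A x * \<Delta> j x \<partial>M) \<longlonglongrightarrow>
       (\<integral>x. indicator A x * g n x \<partial>M) - (\<integral>x. indicator A x * g (N 0) x \<partial>M)"
    proof (rule tendsto_eventually, rule eventually_sequentiallyI)
      fix J assume "n \<le> J"
      then have "n \<le> N J" using N_ge[of J] by simp
      then show "(\<Sum>j<J. \<integral>x. indicator A x * \<Delta> j x \<partial>M)
         = (\<integral>x. indicator A x * g n x \<partial>M) - (\<integral>x. indicator A x * g (N 0) x \<partial>M)"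
        unfolding part by (subst const) auto
    qed
    then have eq: "(\<integral>x. (\<Sum>j. indicator A x * \<Delta> j x) \<partial>M)
       = (\<integral>x. indicator A x * g n x \<partial>M) - (\<integral>x. indicator A x * g (N 0) x \<partial>M)"
      using sumA unfolding sums_def by (rule LIMSEQ_unique[rotated])
    have ptw: "indicator A x * (\<Sum>j. \<Delta> j x) = (\<Sum>j. indicator A x * \<Delta> j x)" for x
      by (auto split: split_indicator)
    have "integrable M (\<lambda>x. indicator A x * (\<Sum>j. \<Delta> j x))"
      using integrable_mult_indicator[OF _ integrable_suminf[OF \<Delta>_int AE_sum sum_int], of A] by simp
    then have "(\<integral>x. indicator A x * a x \<partial>M)
       = (\<integral>x. indicator A x * g (N 0) x \<partial>M) + (\<integral>x. indicator A x * (\<Sum>j. \<Delta> j x) \<partial>M)"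
      unfolding a_def distrib_left by (intro Bochner_Integration.integral_add gA)
    then show "(\<integral>x\<in>A. a x \<partial>M) = (\<integral>x\<in>A. g n x \<partial>M)"
      using eq unfolding ptw set_lebesgue_integral_def by simp
  qed (rule martingaleD[OF g])+
  with a_int show thesis by (rule that)
qed

end

section \<open>Entry times, stopping and coverings\<close>

text \<open>The infimum of the empty set in \<open>enat\<close> is infinity, which is the value at
  points lying in no \<open>B j\<close>.\<close>

definition entry :: "(nat \<Rightarrow> 'a set) \<Rightarrow> 'a \<Rightarrow> enat" where
  "entry B x = Inf (enat ` {j. x \<in> B j})"

lemma le_entry_iff: "enat n \<le> entry B x \<longleftrightarrow> (\<forall>j<n. x \<notin> B j)"
  unfolding entry_def le_Inf_iff by (auto simp: not_less)

lemma entry_less_top_iff: "entry B x < \<infinity> \<longleftrightarrow> (\<exists>j. x \<in> B j)"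
  unfolding entry_def Inf_less_iff by auto

lemma entry_eq_iff: "entry B x = enat n \<longleftrightarrow> x \<in> B n \<and> (\<forall>j<n. x \<notin> B j)"
proof -
  have "entry B x = enat n \<longleftrightarrow> enat n \<le> entry B x \<and> \<not> enat (Suc n) \<le> entry B x"
    by (cases "entry B x") auto
  then show ?thesis unfolding le_entry_iff by (auto simp: less_Suc_eq)
qed

text \<open>The minimum with \<open>enat n\<close> is always finite, so \<open>the_enat\<close> is
  never applied to infinity.\<close>

definition stopped :: "(nat \<Rightarrow> 'a \<Rightarrow> real) \<Rightarrow> ('a \<Rightarrow> enat) \<Rightarrow> nat \<Rightarrow> 'a \<Rightarrow> real" where
  "stopped f \<nu> n x = f (the_enat (min (enat n) (\<nu> x))) x"

lemma stopped_eq: "enat n \<le> \<nu> x \<Longrightarrow> stopped f \<nu> n x = f n x"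
  by (simp add: stopped_def min_def)

lemma stopped_enat: "\<nu> x = enat m \<Longrightarrow> stopped f \<nu> n x = f (min n m) x"
  by (simp add: stopped_def)

text \<open>In this form stopping is a martingale transform: the factor at step \<open>Suc n\<close>
  is the indicator of {\<nu> \<ge> n + 1}, an event of time \<open>n\<close> when
  \<open>\<nu>\<close> is a stopping time.\<close>

lemma stopped_Suc:
  "stopped f \<nu> (Suc n) x = stopped f \<nu> n x + (if enat (Suc n) \<le> \<nu> x then f (Suc n) x - f n x else 0)"
proof (cases "\<nu> x")
  case (enat m)
  then show ?thesis by (cases "Suc n \<le> m") (auto simp: stopped_enat min_def not_less_eq_eq)
qed (auto simp: stopped_eq)

section \<open>Coverings one time step ahead, and stopped martingales\<close>

context filtered_prob
begin

text \<open>For the \<open>R\<close> of \<open>regular_cover\<close> and \<open>D\<close> in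
  \<open>F (Suc n)\<close>, this is an event of time \<open>n\<close> that contains \<open>D\<close>
  up to a null set; by Markov's inequality it is at most \<open>R\<close> times as probable as
  \<open>D\<close>.\<close>

definition cover :: "real \<Rightarrow> nat \<Rightarrow> 'a set \<Rightarrow> 'a set" where
  "cover R n D = {x \<in> space M. 1 / R \<le> condE M F n (indicator D) x}"

lemma cover_sets: "cover R n D \<in> sets (F n)"
proof -
  have "{x \<in> space (F n). 1 / R \<le> condE M F n (indicator D) x} \<in> sets (F n)"
    by measurable
  then show ?thesis by (simp add: cover_def space_F)
qed

lemma integrable_indicator_F: "D \<in> sets (F n) \<Longrightarrow> integrable M (indicat_real D)"
  using sets_F_M[of D n] by (auto simp: integrable_indicator_iff emeasure_eq_measure)

lemma cover_antimono:
  assumes "D \<subseteq> D'" "D \<in> sets (F m)" "D' \<in> sets (F m)"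
  shows "AE x in M. x \<in> cover R n D \<longrightarrow> x \<in> cover R n D'"
proof -
  have "AE x in M. condE M F n (indicator D) x \<le> condE M F n (indicator D') x"
    using assms by (intro CE.real_cond_exp_mono integrable_indicator_F[of _ m])
      (auto split: split_indicator)
  then show ?thesis by eventually_elim (auto simp: cover_def)
qed

text \<open>Regularity is applied to the martingale closed by the indicator of \<open>D\<close>: at
  time \<open>Suc n\<close> it equals the indicator itself, so on \<open>D\<close> its value at time
  \<open>n\<close> is at least 1 / R.\<close>

lemma regular_cover:
  assumes "regular M F"
  obtains R where "R > 0" "\<And>n D. D \<in> sets (F (Suc n)) \<Longrightarrow> AE x in M. x \<in> D \<longrightarrow> x \<in> cover R n D"
proof -
  obtain R where R: "\<And>f n. martingale M F f \<Longrightarrow> (\<And>n. AE x in M. 0 \<le> f n x) \<Longrightarrow> n \<ge> 1 \<Longrightarrow>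
       AE x in M. f n x \<le> R * f (n - 1) x"
    using assms unfolding regular_def by blast
  \<comment> \<open>Regularity asserts no sign for its constant; enlarging it is harmless because
    conditional probabilities are nonnegative.\<close>
  define R' where "R' = max R 1"
  have "AE x in M. x \<in> D \<longrightarrow> x \<in> cover R' n D" if D: "D \<in> sets (F (Suc n))" for n D
  proof -
    have int: "integrable M (indicat_real D)" by (rule integrable_indicator_F[OF D])
    have pos: "AE x in M. 0 \<le> condE M F m (indicator D) x" for m
      using sets_F_M[OF D] by (intro CE.real_cond_exp_pos) auto
    have "AE x in M. condE M F (Suc n) (indicator D) x \<le> R * condE M F (Suc n - 1) (indicator D) x"
      by (rule R[OF martingale_closed[OF int] pos]) simp
    moreover have "AE x in M. condE M F (Suc n) (indicator D) x = indicator D x"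
      using D by (intro CE.real_cond_exp_F_meas int) auto
    ultimately show ?thesis using pos[of n] AE_space
    proof eventually_elim
      case (elim x)
      have "R * condE M F n (indicator D) x \<le> R' * condE M F n (indicator D) x"
        using elim(3) by (intro mult_right_mono) (auto simp: R'_def)
      with elim show ?case
        by (auto simp: cover_def R'_def field_simps)
    qed
  qed
  moreover have "R' > 0" by (simp add: R'_def)
  ultimately show thesis by (intro that)
qed

lemma stopping_entry:
  assumes "\<And>n. B n \<in> sets (F n)"
  shows "stopping M F (entry B)"
  unfolding stopping_def entry_eq_iff
proof
  fix n
  have "B j \<in> sets (F n)" if "j \<le> n" for j using assms[of j] sets_F_mono[OF that] by auto
  then have "B n - (\<Union>j<n. B j) \<in> sets (F n)" by auto
  moreover have "{x \<in> space M. x \<in> B n \<and> (\<forall>j<n. x \<notin> B j)} = B n - (\<Union>j<n. B j)"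
    using sets.sets_into_space[OF assms[of n]] by (auto simp: space_F)
  ultimately show "{x \<in> space M. x \<in> B n \<and> (\<forall>j<n. x \<notin> B j)} \<in> sets (F n)" by simp
qed

text \<open>A weighted form of Markov's inequality. On the part \<open>N n\<close> first entered at
  time \<open>n\<close>, the factor \<open>R\<close> brings in the conditional probability of
  \<open>D n\<close>, \<open>K\<close> moves the conditional weight from time \<open>n\<close> to
  \<open>Suc n\<close>, and there it integrates exactly over \<open>N n \<inter> D n\<close>. These
  pieces are disjoint.\<close>

lemma cover_weight_bound:
  fixes w :: "'a \<Rightarrow> real"
  assumes RK: "R > 0" "K > 0" and w: "integrable M w" "\<And>x. x \<in> space M \<Longrightarrow> 0 \<le> w x"
    and wK: "\<And>n. AE x in M. condE M F n w x \<le> K * condE M F (Suc n) w x"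
    and D: "\<And>n. D n \<in> sets (F (Suc n))"
  shows "(\<integral>\<^sup>+x. ennreal (w x) * indicator (\<Union>n. cover R n (D n)) x \<partial>M)
     \<le> ennreal (R * K) * (\<integral>\<^sup>+x. ennreal (w x) * indicator (\<Union>n. D n) x \<partial>M)"
proof -
  define N where "N = disjointed (\<lambda>n. cover R n (D n))"
  have disj: "disjoint_family N" unfolding N_def by (rule disjoint_family_disjointed)
  have UN: "(\<Union>n. cover R n (D n)) = (\<Union>n. N n)" unfolding N_def by (rule UN_disjointed_eq[symmetric])
  have N_sub: "N n \<subseteq> cover R n (D n)" for n unfolding N_def by (rule disjointed_subset)
  have N_F: "N n \<in> sets (F n)" for n
  proof -
    have "cover R j (D j) \<in> sets (F n)" if "j \<le> n" for j
      using cover_sets[of R j "D j"] sets_F_mono[OF that] by auto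
    then show ?thesis unfolding N_def disjointed_def by auto
  qed
  have [measurable]: "N n \<in> sets M" "D n \<in> sets M" for n
    using sets_F_M N_F D by blast+
  have [measurable]: "w \<in> borel_measurable M" using w by auto
  have wpos: "AE x in M. 0 \<le> condE M F n w x" for n
    using w by (intro CE.real_cond_exp_pos) auto
  have wi: "integrable M (condE M F n w)" for n by (rule CE.real_cond_exp_int[OF w(1)])
  have intI: "integrable M (\<lambda>x. indicator A x * g x)" if "A \<in> sets M" "integrable M g" for A and g :: "'a \<Rightarrow> real"
    using integrable_mult_indicator[OF that] by simp
  have step: "(\<integral>x. indicator (N n) x * w x \<partial>M) \<le> R * K * (\<integral>x. indicator (N n \<inter> D n) x * w x \<partial>M)" for n
  proof -
    let ?d = "condE M F n (indicator (D n))"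
    have di: "integrable M (indicat_real (D n))" by (rule integrable_indicator_F[OF D])
    \<comment> \<open>An \<open>F n\<close>-measurable factor, which allows the conditional
      expectation to be taken off the indicator of \<open>D n\<close>.\<close>
    define h where "h x = indicator (N n) x * condE M F n w x" for x
    have h_F: "h \<in> borel_measurable (F n)" unfolding h_def using N_F by measurable
    have h_D: "integrable M (\<lambda>x. h x * indicator (D n) x)"
      unfolding h_def using intI[of "N n \<inter> D n", OF _ wi[of n]]
      by (simp add: indicator_inter_arith ac_simps)
    have h_d: "integrable M (\<lambda>x. h x * ?d x)"
      by (rule CE.real_cond_exp_intg(1)[OF h_D h_F]) auto
    have "(\<integral>x. indicator (N n) x * w x \<partial>M) = (\<integral>x. indicator (N n) x * condE M F n w x \<partial>M)"
      using N_F by (intro CE.real_cond_exp_intg(2)[symmetric] intI w) auto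
    also have "\<dots> \<le> (\<integral>x. R * (h x * ?d x) \<partial>M)"
    proof (rule integral_mono_AE)
      show "AE x in M. indicator (N n) x * condE M F n w x \<le> R * (h x * ?d x)"
        using wpos[of n]
      proof eventually_elim
        case (elim x)
        show ?case
        proof (cases "x \<in> N n")
          case True
          then have "1 / R \<le> ?d x" using N_sub[of n] by (auto simp: cover_def)
          then have "1 \<le> R * ?d x" using RK by (simp add: field_simps)
          then have "condE M F n w x * 1 \<le> condE M F n w x * (R * ?d x)"
            using elim by (intro mult_left_mono) auto
          then show ?thesis using True by (simp add: h_def ac_simps)
        qed (simp add: h_def)
      qed
    qed (use intI wi h_d in auto)
    also have "\<dots> = R * (\<integral>x. h x * indicator (D n) x \<partial>M)"
      using CE.real_cond_exp_intg(2)[OF h_D h_F] by simp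
    \<comment> \<open>The time shift is forced: \<open>D n\<close> is an event of time
      \<open>Suc n\<close>, and only the conditional weight of that time can be replaced by
      \<open>w\<close> under the integral.\<close>
    also have "(\<integral>x. h x * indicator (D n) x \<partial>M)
       \<le> (\<integral>x. K * (indicator (N n \<inter> D n) x * condE M F (Suc n) w x) \<partial>M)"
    proof (rule integral_mono_AE[OF h_D])
      show "AE x in M. h x * indicator (D n) x \<le> K * (indicator (N n \<inter> D n) x * condE M F (Suc n) w x)"
        using wK[of n] by eventually_elim (auto simp: h_def split: split_indicator)
    qed (intro integrable_mult_right intI wi, measurable)
    also have "\<dots> = K * (\<integral>x. indicator (N n \<inter> D n) x * condE M F (Suc n) w x \<partial>M)" by simp
    also have "(\<integral>x. indicator (N n \<inter> D n) x * condE M F (Suc n) w x \<partial>M) = (\<integral>x. indicator (N n \<inter> D n) x * w x \<partial>M)"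
    proof (rule CE.real_cond_exp_intg(2))
      have "N n \<inter> D n \<in> sets (F (Suc n))" using D[of n] N_F[of n] sets_F_mono[of n "Suc n"] by auto
      then show "indicat_real (N n \<inter> D n) \<in> borel_measurable (F (Suc n))" by auto
    qed (use intI w in auto)
    finally show ?thesis using RK by (simp add: mult_left_mono)
  qed
  have nn: "(\<integral>\<^sup>+x. ennreal (w x) * indicator A x \<partial>M) = ennreal (\<integral>x. indicator A x * w x \<partial>M)"
    if [measurable]: "A \<in> sets M" for A
  proof -
    have "(\<integral>\<^sup>+x. ennreal (w x) * indicator A x \<partial>M) = (\<integral>\<^sup>+x. ennreal (indicator A x * w x) \<partial>M)"
      by (intro nn_integral_cong) (auto split: split_indicator)
    also have "\<dots> = ennreal (\<integral>x. indicator A x * w x \<partial>M)"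
      using w by (intro nn_integral_eq_integral intI) (auto split: split_indicator)
    finally show ?thesis .
  qed
  have "(\<integral>\<^sup>+x. ennreal (w x) * indicator (\<Union>n. cover R n (D n)) x \<partial>M)
      = (\<integral>\<^sup>+x. (\<Sum>n. ennreal (w x) * indicator (N n) x) \<partial>M)"
    unfolding UN by (intro nn_integral_cong) (simp add: suminf_indicator[OF disj])
  also have "\<dots> = (\<Sum>n. \<integral>\<^sup>+x. ennreal (w x) * indicator (N n) x \<partial>M)"
    by (rule nn_integral_suminf) auto
  also have "\<dots> \<le> (\<Sum>n. ennreal (R * K) * (\<integral>\<^sup>+x. ennreal (w x) * indicator (N n \<inter> D n) x \<partial>M))"
  proof (rule suminf_le)
    fix n
    show "(\<integral>\<^sup>+x. ennreal (w x) * indicator (N n) x \<partial>M)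
       \<le> ennreal (R * K) * (\<integral>\<^sup>+x. ennreal (w x) * indicator (N n \<inter> D n) x \<partial>M)"
      using step[of n] RK by (simp add: nn ennreal_mult'[symmetric] ennreal_leI)
  qed auto
  also have "\<dots> = ennreal (R * K) * (\<Sum>n. \<integral>\<^sup>+x. ennreal (w x) * indicator (N n \<inter> D n) x \<partial>M)"
    by simp
  also have "(\<Sum>n. \<integral>\<^sup>+x. ennreal (w x) * indicator (N n \<inter> D n) x \<partial>M)
     = (\<integral>\<^sup>+x. (\<Sum>n. ennreal (w x) * indicator (N n \<inter> D n) x) \<partial>M)"
    by (rule nn_integral_suminf[symmetric]) auto
  also have "\<dots> = (\<integral>\<^sup>+x. ennreal (w x) * indicator (\<Union>n. N n \<inter> D n) x \<partial>M)"
  proof (intro nn_integral_cong)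
    fix x
    have "disjoint_family (\<lambda>n. N n \<inter> D n)" using disj by (auto simp: disjoint_family_on_def)
    then show "(\<Sum>n. ennreal (w x) * indicator (N n \<inter> D n) x) = ennreal (w x) * indicator (\<Union>n. N n \<inter> D n) x"
      by (simp add: suminf_indicator)
  qed
  also have "\<dots> \<le> (\<integral>\<^sup>+x. ennreal (w x) * indicator (\<Union>n. D n) x \<partial>M)"
    by (intro nn_integral_mono mult_left_mono) (auto split: split_indicator)
  finally show ?thesis by (simp add: mult_left_mono)
qed

text \<open>The indicator of \<open>P n\<close>, an event of time \<open>n\<close>, can be taken out
  of the conditional expectation of the increment of \<open>f\<close>, which vanishes.\<close>

lemma martingale_stopped:
  assumes f: "martingale M F f" and \<nu>: "stopping M F \<nu>"
  shows "martingale M F (stopped f \<nu>)"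
proof -
  define P where "P n = {x \<in> space M. enat (Suc n) \<le> \<nu> x}" for n
  have P_F: "P n \<in> sets (F n)" for n
  proof -
    have "{x \<in> space M. \<nu> x = enat j} \<in> sets (F n)" if "j \<le> n" for j
      using \<nu> sets_F_mono[OF that] by (auto simp: stopping_def)
    then have "space (F n) - (\<Union>j\<le>n. {x \<in> space M. \<nu> x = enat j}) \<in> sets (F n)" by auto
    also have "space (F n) - (\<Union>j\<le>n. {x \<in> space M. \<nu> x = enat j}) = P n"
    proof -
      have "enat (Suc n) \<le> \<nu> x \<longleftrightarrow> (\<forall>j\<le>n. \<nu> x \<noteq> enat j)" for x
        by (cases "\<nu> x") (auto simp: not_less_eq_eq)
      then show ?thesis by (auto simp: P_def space_F)
    qed
    finally show ?thesis .
  qed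
  have P_M [measurable]: "P n \<in> sets M" for n by (rule sets_F_M[OF P_F])
  have [measurable]: "f n \<in> borel_measurable M" for n by (rule martingaleD[OF f])
  have f_F: "f m \<in> borel_measurable (F n)" if "m \<le> n" for m n
    by (rule measurable_F_mono[OF martingaleD(2)[OF f] that])
  have di: "integrable M (\<lambda>x. indicator (P n) x * (f (Suc n) x - f n x))" for n
    using integrable_mult_indicator[OF P_M, of "\<lambda>x. f (Suc n) x - f n x" n] martingaleD(1)[OF f] by simp
  have step: "stopped f \<nu> (Suc n) x = stopped f \<nu> n x + indicator (P n) x * (f (Suc n) x - f n x)"
    if "x \<in> space M" for n x
    using that by (auto simp: stopped_Suc P_def)
  have base: "integrable M (stopped f \<nu> n) \<and> stopped f \<nu> n \<in> borel_measurable (F n)" for n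
  proof (induction n)
    case 0
    have "stopped f \<nu> 0 = f 0" by (rule ext, rule stopped_eq) (simp add: zero_enat_def[symmetric])
    then show ?case using martingaleD[OF f] by simp
  next
    case (Suc n)
    have "stopped f \<nu> n \<in> borel_measurable (F (Suc n))"
      using Suc.IH by (auto intro: measurable_F_mono[of _ n])
    moreover have "P n \<in> sets (F (Suc n))" using P_F[of n] sets_F_mono[of n "Suc n"] by auto
    ultimately have "(\<lambda>x. stopped f \<nu> n x + indicator (P n) x * (f (Suc n) x - f n x)) \<in> borel_measurable (F (Suc n))"
      using f_F[of "Suc n" "Suc n"] f_F[of n "Suc n"] by measurable
    moreover have "integrable M (\<lambda>x. stopped f \<nu> n x + indicator (P n) x * (f (Suc n) x - f n x))"
      using Suc.IH di[of n] by auto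
    \<comment> \<open>The recursion \<open>step\<close> holds only on \<open>space M\<close>, so
      both properties are carried over by congruence rules.\<close>
    ultimately show ?case
      using step[of _ n] Bochner_Integration.integrable_cong[OF refl, of M "stopped f \<nu> (Suc n)"
         "\<lambda>x. stopped f \<nu> n x + indicator (P n) x * (f (Suc n) x - f n x)"]
        measurable_cong[of "F (Suc n)" "stopped f \<nu> (Suc n)"
         "\<lambda>x. stopped f \<nu> n x + indicator (P n) x * (f (Suc n) x - f n x)"]
      by (simp add: space_F)
  qed
  have [measurable]: "stopped f \<nu> n \<in> borel_measurable M" for n
    using base by auto
  have "AE x in M. condE M F n (stopped f \<nu> (Suc n)) x = stopped f \<nu> n x" for n
  proof -
    let ?d = "\<lambda>x. f (Suc n) x - f n x"
    have "AE x in M. condE M F n (stopped f \<nu> (Suc n)) x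
         = condE M F n (\<lambda>x. stopped f \<nu> n x + indicator (P n) x * ?d x) x"
      by (intro CE.real_cond_exp_cong AE_I2 step) measurable
    moreover have "AE x in M. condE M F n (\<lambda>x. stopped f \<nu> n x + indicator (P n) x * ?d x) x
        = condE M F n (stopped f \<nu> n) x + condE M F n (\<lambda>x. indicator (P n) x * ?d x) x"
      using base di by (intro CE.real_cond_exp_add) auto
    moreover have "AE x in M. condE M F n (stopped f \<nu> n) x = stopped f \<nu> n x"
      using base by (intro CE.real_cond_exp_F_meas) auto
    moreover have "AE x in M. condE M F n (\<lambda>x. indicator (P n) x * ?d x) x = indicator (P n) x * condE M F n ?d x"
      using P_F[of n] di by (intro CE.real_cond_exp_mult) auto
    moreover have "AE x in M. condE M F n ?d x = condE M F n (f (Suc n)) x - condE M F n (f n) x"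
      by (intro CE.real_cond_exp_diff martingaleD[OF f])
    moreover have "AE x in M. condE M F n (f n) x = f n x"
      by (intro CE.real_cond_exp_F_meas martingaleD[OF f])
    moreover note martingaleD(4)[OF f, of n]
    ultimately show ?thesis by eventually_elim simp
  qed
  then show ?thesis using base by (auto simp: martingale_def)
qed

end

section \<open>Maximal and square functions as trajectory seminorms\<close>

lemma summable_on_ennreal_fun [simp]: "(u :: 'b \<Rightarrow> ennreal) summable_on A"
  by (rule nonneg_summable_on_complete) simp

lemma sum_le_infsum_ennreal:
  fixes u :: "'b \<Rightarrow> ennreal"
  assumes "finite K" "K \<subseteq> A"
  shows "sum u K \<le> infsum u A"
  by (subst nonneg_infsum_complete) (use assms in \<open>auto intro: SUP_upper\<close>)

lemma epow_mono: "u \<le> v \<Longrightarrow> 0 < r \<Longrightarrow> epow u r \<le> epow v r"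
  by (auto simp: epow_def top_unique less_top[symmetric] intro!: ennreal_leI powr_mono2 enn2real_mono)

text \<open>Each \<open>v k powr r\<close> is at most the total \<open>s\<close>. Writing v = v^r
  (v^r)^(1/r - 1) and bounding the last factor by s^(1/r - 1), whose exponent is nonnegative because
  r \<le> 1, gives the total s s^(1/r - 1) = s^(1/r).\<close>

lemma sum_le_epow_infsum:
  fixes u :: "'b \<Rightarrow> ennreal"
  assumes r: "0 < r" "r \<le> 1" and K: "finite K"
  shows "sum u K \<le> epow (\<Sum>\<^sub>\<infinity>k\<in>UNIV. epow (u k) r) (1 / r)"
proof (cases "(\<Sum>\<^sub>\<infinity>k\<in>UNIV. epow (u k) r) = \<top>")
  case False
  define s where "s = enn2real (\<Sum>\<^sub>\<infinity>k\<in>UNIV. epow (u k) r)"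
  have S: "(\<Sum>\<^sub>\<infinity>k\<in>UNIV. epow (u k) r) = ennreal s"
    using False by (simp add: s_def less_top)
  have s0: "0 \<le> s" by (simp add: s_def)
  have le: "sum (\<lambda>k. epow (u k) r) J \<le> ennreal s" if "finite J" for J
    unfolding S[symmetric] by (rule sum_le_infsum_ennreal) (auto simp: that)
  have fin: "u k \<noteq> \<top>" for k
  proof
    assume "u k = \<top>"
    then show False using le[of "{k}"] by (simp add: epow_def top_unique)
  qed
  define v where "v k = enn2real (u k)" for k
  have u: "u k = ennreal (v k)" for k using fin[of k] by (simp add: v_def less_top)
  have v0: "0 \<le> v k" for k by (simp add: v_def)
  have ep: "epow (u k) r = ennreal (v k powr r)" for k using fin[of k] by (simp add: epow_def v_def)
  have le': "(\<Sum>k\<in>J. v k powr r) \<le> s" if "finite J" for J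
    using le[OF that] s0 by (simp add: ep sum_ennreal)
  have "v k \<le> v k powr r * s powr (1 / r - 1)" for k
  proof (cases "v k = 0")
    case False
    have "v k = v k powr r * (v k powr r) powr (1 / r - 1)"
      using False v0[of k] r by (simp add: powr_powr powr_add[symmetric] field_simps)
    also have "\<dots> \<le> v k powr r * s powr (1 / r - 1)"
      using le'[of "{k}"] r by (intro mult_left_mono powr_mono2) auto
    finally show ?thesis .
  qed simp
  then have "(\<Sum>k\<in>K. v k) \<le> (\<Sum>k\<in>K. v k powr r * s powr (1 / r - 1))" by (rule sum_mono)
  also have "\<dots> = (\<Sum>k\<in>K. v k powr r) * s powr (1 / r - 1)" by (rule sum_distrib_right[symmetric])
  also have "\<dots> \<le> s * s powr (1 / r - 1)" using le'[OF K] by (intro mult_right_mono) auto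
  also have "\<dots> = s powr (1 / r)"
    using s0 r by (cases "s = 0") (auto simp: powr_diff)
  finally have "ennreal (\<Sum>k\<in>K. v k) \<le> ennreal (s powr (1 / r))" by (rule ennreal_leI)
  moreover have "sum u K = ennreal (\<Sum>k\<in>K. v k)" by (simp add: u sum_ennreal v0)
  ultimately show ?thesis unfolding S using s0 by (simp add: epow_def)
qed (simp add: epow_def)

lemma infsum_le_epow_infsum:
  fixes u :: "'b \<Rightarrow> ennreal"
  assumes "0 < r" "r \<le> 1"
  shows "(\<Sum>\<^sub>\<infinity>k\<in>UNIV. u k) \<le> epow (\<Sum>\<^sub>\<infinity>k\<in>UNIV. epow (u k) r) (1 / r)"
  by (rule infsum_le_finite_sums) (auto intro: sum_le_epow_infsum assms)

text \<open>The common shape of \<open>maxf\<close> and \<open>sqf\<close>, see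
  \<open>maxf_eq\<close> and \<open>sqf_eq\<close>.\<close>

definition fnorm :: "(nat \<Rightarrow> (nat \<Rightarrow> real) \<Rightarrow> real) \<Rightarrow> (nat \<Rightarrow> 'a \<Rightarrow> real) \<Rightarrow> 'a \<Rightarrow> ennreal" where
  "fnorm q f x = (SUP n. ennreal (q n (\<lambda>i. f i x)))"

text \<open>
  The functionals \<open>q n u\<close> are truncated versions of the maximal function and of the square function,
  evaluated along a single trajectory \<open>u\<close>. The first case of \<open>square\<close> holds for the maximal
  function, the second one for the square function; either bounds martingales in \<open>L\<^sup>2\<close>.
\<close>

locale trajectory_seminorm =
  fixes q :: "nat \<Rightarrow> (nat \<Rightarrow> real) \<Rightarrow> real"
  assumes nonneg: "0 \<le> q n u"
    and triangle: "q n (\<lambda>i. u i + v i) \<le> q n u + q n v"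
    and scale: "q n (\<lambda>i. c * u i) = \<bar>c\<bar> * q n u"
    and tendsto: "(\<And>i. ((\<lambda>z. U z i) \<longlongrightarrow> u i) G) \<Longrightarrow> ((\<lambda>z. q n (U z)) \<longlongrightarrow> q n u) (G :: int set filter)"
    and mono: "m \<le> n \<Longrightarrow> q m u \<le> q n u"
    and stop: "q n (\<lambda>i. u (min i m)) = q (min n m) u"
    and increment: "\<bar>u (Suc i) - u i\<bar> \<le> 2 * q (Suc i) u"
    and zero: "u 0 = 0 \<Longrightarrow> q 0 u = 0"
    and square: "(\<forall>n u. \<bar>u n\<bar> \<le> q n u) \<or> (\<forall>n u. (\<Sum>i<n. (u (Suc i) - u i)\<^sup>2) \<le> (q n u)\<^sup>2)"
begin

lemma q_0 [simp]: "q n (\<lambda>i. 0) = 0"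
  using scale[of n 0 "\<lambda>_. 0"] by simp

lemma q_diff: "q n (\<lambda>i. u i - v i) \<le> q n u + q n v"
  using triangle[of n u "\<lambda>i. - 1 * v i"] scale[of n "-1" v] by simp

lemma q_sum:
  assumes "finite K" "\<And>k. k \<in> K \<Longrightarrow> 0 \<le> \<mu> k"
  shows "q n (\<lambda>i. \<Sum>k\<in>K. \<mu> k * u k i) \<le> (\<Sum>k\<in>K. \<mu> k * q n (u k))"
  using assms
proof (induction K)
  case (insert k K)
  have "q n (\<lambda>i. \<Sum>k\<in>insert k K. \<mu> k * u k i) = q n (\<lambda>i. \<mu> k * u k i + (\<Sum>k\<in>K. \<mu> k * u k i))"
    using insert by simp
  also have "\<dots> \<le> q n (\<lambda>i. \<mu> k * u k i) + q n (\<lambda>i. \<Sum>k\<in>K. \<mu> k * u k i)" by (rule triangle)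
  also have "q n (\<lambda>i. \<mu> k * u k i) = \<mu> k * q n (u k)" using insert.prems by (simp add: scale)
  finally show ?case using insert by force
qed simp

text \<open>Finite subadditivity passes to the limit along finite index sets because a single
  truncation \<open>q n\<close> is continuous in the trajectory; the supremum over \<open>n\<close>
  enters only on the right.\<close>

lemma q_has_sum_le:
  fixes \<mu> :: "int \<Rightarrow> real"
  assumes sum: "\<And>i. ((\<lambda>k. \<mu> k * u k i) has_sum v i) UNIV" and \<mu>: "\<And>k. 0 \<le> \<mu> k"
  shows "ennreal (q n v) \<le> (\<Sum>\<^sub>\<infinity>k\<in>UNIV. ennreal (\<mu> k) * (SUP n. ennreal (q n (u k))))"
proof (rule tendsto_upperbound)
  show "((\<lambda>K. ennreal (q n (\<lambda>i. \<Sum>k\<in>K. \<mu> k * u k i))) \<longlongrightarrow> ennreal (q n v)) (finite_subsets_at_top UNIV)"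
    using sum by (intro tendsto_ennrealI tendsto) (auto simp: has_sum_def)
  have "ennreal (q n (\<lambda>i. \<Sum>k\<in>K. \<mu> k * u k i))
      \<le> (\<Sum>\<^sub>\<infinity>k\<in>UNIV. ennreal (\<mu> k) * (SUP n. ennreal (q n (u k))))" if "finite K" for K
  proof -
    have "ennreal (q n (\<lambda>i. \<Sum>k\<in>K. \<mu> k * u k i)) \<le> ennreal (\<Sum>k\<in>K. \<mu> k * q n (u k))"
      using that \<mu> by (intro ennreal_leI q_sum)
    also have "\<dots> = (\<Sum>k\<in>K. ennreal (\<mu> k) * ennreal (q n (u k)))"
      using \<mu> nonneg by (simp add: sum_ennreal[symmetric] ennreal_mult)
    also have "\<dots> \<le> (\<Sum>k\<in>K. ennreal (\<mu> k) * (SUP n. ennreal (q n (u k))))"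
      by (intro sum_mono mult_left_mono SUP_upper) auto
    also have "\<dots> \<le> (\<Sum>\<^sub>\<infinity>k\<in>UNIV. ennreal (\<mu> k) * (SUP n. ennreal (q n (u k))))"
      using that by (intro sum_le_infsum_ennreal) auto
    finally show ?thesis .
  qed
  then show "\<forall>\<^sub>F K in finite_subsets_at_top UNIV. ennreal (q n (\<lambda>i. \<Sum>k\<in>K. \<mu> k * u k i))
      \<le> (\<Sum>\<^sub>\<infinity>k\<in>UNIV. ennreal (\<mu> k) * (SUP n. ennreal (q n (u k))))"
    by (auto intro: eventually_finite_subsets_at_top_weakI)
qed simp

text \<open>Freezing the trajectory at m = \<nu> x reduces \<open>q n\<close> to
  \<open>q (min n m)\<close>, and min n m \<le> \<nu> x. A bound valid up to and including the
  stopping time thus holds at all times.\<close>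

lemma q_stopped_le:
  assumes "\<And>n. enat n \<le> \<nu> x \<Longrightarrow> q n (\<lambda>i. f i x) \<le> b"
  shows "q n (\<lambda>i. stopped f \<nu> i x) \<le> b"
proof (cases "\<nu> x")
  case (enat m)
  then have "q n (\<lambda>i. stopped f \<nu> i x) = q (min n m) (\<lambda>i. f i x)"
    using stop[of n "\<lambda>i. f i x" m] by (simp add: stopped_enat)
  then show ?thesis using assms[of "min n m"] enat by simp
next
  case infinity
  then show ?thesis using assms[of n] by (simp add: stopped_eq)
qed

end

lemma L2_set_tendsto:
  assumes "\<And>i. ((\<lambda>z. U z i) \<longlongrightarrow> u i) G"
  shows "((\<lambda>z. L2_set (U z) A) \<longlongrightarrow> L2_set u A) G"
  unfolding L2_set_def by (intro tendsto_intros assms)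

section \<open>The running maximum and the truncated square function\<close>

definition qmax :: "nat \<Rightarrow> (nat \<Rightarrow> real) \<Rightarrow> real" where
  "qmax n u = (MAX i\<in>{..n}. \<bar>u i\<bar>)"

definition qsq :: "nat \<Rightarrow> (nat \<Rightarrow> real) \<Rightarrow> real" where
  "qsq n u = L2_set (\<lambda>i. u (Suc i) - u i) {..<n}"

lemma qmax_le_iff: "qmax n u \<le> b \<longleftrightarrow> (\<forall>i\<le>n. \<bar>u i\<bar> \<le> b)"
  unfolding qmax_def by (subst Max_le_iff) auto

lemma abs_le_qmax: "i \<le> n \<Longrightarrow> \<bar>u i\<bar> \<le> qmax n u"
  using qmax_le_iff[of n u "qmax n u"] by simp

lemma qmax_0: "qmax 0 u = \<bar>u 0\<bar>" by (simp add: qmax_def)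

lemma qmax_Suc: "qmax (Suc n) u = max \<bar>u (Suc n)\<bar> (qmax n u)"
  unfolding qmax_def atMost_Suc by (simp add: Max_insert)

interpretation qmax: trajectory_seminorm qmax
proof
  fix n m i :: nat and u v :: "nat \<Rightarrow> real" and c :: real and U :: "int set \<Rightarrow> nat \<Rightarrow> real" and G
  show "0 \<le> qmax n u" using abs_le_qmax[of 0 n u] by simp
  have "\<bar>u i + v i\<bar> \<le> qmax n u + qmax n v" if "i \<le> n" for i
    using abs_le_qmax[OF that, of u] abs_le_qmax[OF that, of v] by linarith
  then show "qmax n (\<lambda>i. u i + v i) \<le> qmax n u + qmax n v" by (simp add: qmax_le_iff)
  show "qmax n (\<lambda>i. c * u i) = \<bar>c\<bar> * qmax n u"
    by (induction n) (auto simp: qmax_0 qmax_Suc abs_mult max_mult_distrib_left)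
  show "((\<lambda>z. qmax n (U z)) \<longlongrightarrow> qmax n u) G" if "\<And>i. ((\<lambda>z. U z i) \<longlongrightarrow> u i) G"
    by (induction n) (auto simp: qmax_0 qmax_Suc intro!: tendsto_intros tendsto_max that)
  show "qmax m u \<le> qmax n u" if "m \<le> n"
    using that by (auto simp: qmax_le_iff[of m] intro: abs_le_qmax)
  show "qmax n (\<lambda>i. u (min i m)) = qmax (min n m) u"
  proof (rule antisym)
    show "qmax n (\<lambda>i. u (min i m)) \<le> qmax (min n m) u"
      unfolding qmax_le_iff[of n] by (auto intro!: abs_le_qmax)
    have "\<bar>u i\<bar> \<le> qmax n (\<lambda>i. u (min i m))" if "i \<le> min n m" for i
      using abs_le_qmax[of i n "\<lambda>i. u (min i m)"] that by (simp add: min_absorb1)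
    then show "qmax (min n m) u \<le> qmax n (\<lambda>i. u (min i m))"
      unfolding qmax_le_iff[of "min n m"] by blast
  qed
  show "\<bar>u (Suc i) - u i\<bar> \<le> 2 * qmax (Suc i) u"
    using abs_le_qmax[of i "Suc i" u] abs_le_qmax[of "Suc i" "Suc i" u] by simp
  show "qmax 0 u = 0" if "u 0 = 0" using that by (simp add: qmax_0)
  show "(\<forall>n u. \<bar>u n\<bar> \<le> qmax n u) \<or> (\<forall>n u. (\<Sum>i<n. (u (Suc i) - u i)\<^sup>2) \<le> (qmax n u)\<^sup>2)"
    by (auto intro: abs_le_qmax)
qed

interpretation qsq: trajectory_seminorm qsq
proof
  fix n m i :: nat and u v :: "nat \<Rightarrow> real" and c :: real and U :: "int set \<Rightarrow> nat \<Rightarrow> real" and G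
  show "0 \<le> qsq n u" by (simp add: qsq_def)
  show "qsq n (\<lambda>i. u i + v i) \<le> qsq n u + qsq n v"
    using L2_set_triangle_ineq[of "\<lambda>i. u (Suc i) - u i" "\<lambda>i. v (Suc i) - v i" "{..<n}"]
    by (simp add: qsq_def algebra_simps)
  show "qsq n (\<lambda>i. c * u i) = \<bar>c\<bar> * qsq n u"
    by (simp add: qsq_def L2_set_def right_diff_distrib[symmetric] power_mult_distrib
        sum_distrib_left[symmetric] real_sqrt_mult)
  show "((\<lambda>z. qsq n (U z)) \<longlongrightarrow> qsq n u) G" if "\<And>i. ((\<lambda>z. U z i) \<longlongrightarrow> u i) G"
    unfolding qsq_def by (intro L2_set_tendsto tendsto_diff that)
  show "qsq m u \<le> qsq n u" if "m \<le> n"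
    unfolding qsq_def L2_set_def using that by (intro real_sqrt_le_mono sum_mono2) auto
  show "qsq n (\<lambda>i. u (min i m)) = qsq (min n m) u"
  proof -
    have "(\<Sum>i<n. (u (min (Suc i) m) - u (min i m))\<^sup>2) = (\<Sum>i<min n m. (u (Suc i) - u i)\<^sup>2)"
    proof (rule sum.mono_neutral_cong_right)
      show "\<forall>i\<in>{..<n} - {..<min n m}. (u (min (Suc i) m) - u (min i m))\<^sup>2 = 0"
        by (auto simp: not_less min_absorb2)
    qed (auto simp: min_absorb1)
    then show ?thesis by (simp add: qsq_def L2_set_def)
  qed
  show "\<bar>u (Suc i) - u i\<bar> \<le> 2 * qsq (Suc i) u"
  proof -
    have "\<bar>u (Suc i) - u i\<bar> \<le> L2_set (\<lambda>i. \<bar>u (Suc i) - u i\<bar>) {..<Suc i}"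
      by (rule member_le_L2_set[of _ _ "\<lambda>i. \<bar>u (Suc i) - u i\<bar>"]) auto
    also have "\<dots> = qsq (Suc i) u" by (simp only: qsq_def L2_set_def power2_abs)
    finally show ?thesis by linarith
  qed
  show "qsq 0 u = 0" if "u 0 = 0" by (simp add: qsq_def)
  show "(\<forall>n u. \<bar>u n\<bar> \<le> qsq n u) \<or> (\<forall>n u. (\<Sum>i<n. (u (Suc i) - u i)\<^sup>2) \<le> (qsq n u)\<^sup>2)"
    by (simp add: qsq_def L2_set_def sum_nonneg)
qed

lemma qmax_measurable:
  assumes "\<And>i. i \<le> n \<Longrightarrow> g i \<in> borel_measurable N"
  shows "(\<lambda>x. qmax n (\<lambda>i. g i x)) \<in> borel_measurable N"
  using assms
proof (induction n)
  case 0
  then have [measurable]: "g 0 \<in> borel_measurable N" by simp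
  show ?case by (simp add: qmax_0)
next
  case (Suc n)
  then have [measurable]: "g (Suc n) \<in> borel_measurable N"
    "(\<lambda>x. qmax n (\<lambda>i. g i x)) \<in> borel_measurable N" by auto
  show ?case by (simp add: qmax_Suc)
qed

lemma qsq_measurable:
  assumes "\<And>i. i \<le> n \<Longrightarrow> g i \<in> borel_measurable N"
  shows "(\<lambda>x. qsq n (\<lambda>i. g i x)) \<in> borel_measurable N"
proof -
  have "(\<lambda>x. \<Sum>i<n. (g (Suc i) x - g i x)\<^sup>2) \<in> borel_measurable N"
    by (intro borel_measurable_sum borel_measurable_power borel_measurable_diff assms) auto
  then show ?thesis unfolding qsq_def L2_set_def by measurable
qed

lemma maxf_eq: "maxf = fnorm qmax"
proof (intro ext antisym)
  fix f :: "nat \<Rightarrow> 'a \<Rightarrow> real" and x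
  show "maxf f x \<le> fnorm qmax f x"
    unfolding maxf_def fnorm_def
    by (rule SUP_mono) (auto intro!: ennreal_leI abs_le_qmax)
  have "ennreal (qmax n (\<lambda>i. f i x)) \<le> maxf f x" for n
  proof -
    have "qmax n (\<lambda>i. f i x) \<in> (\<lambda>i. \<bar>f i x\<bar>) ` {..n}"
      unfolding qmax_def by (rule Max_in) auto
    then obtain i where "qmax n (\<lambda>i. f i x) = \<bar>f i x\<bar>" by auto
    then show ?thesis unfolding maxf_def by (metis SUP_upper UNIV_I)
  qed
  then show "fnorm qmax f x \<le> maxf f x" unfolding fnorm_def by (rule SUP_least)
qed

text \<open>\<open>epow\<close> treats infinity separately. If the sum is infinite, a finite
  supremum of the roots would bound all partial sums; if it is finite, the square root is
  continuous.\<close>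

lemma sqf_eq: "sqf = fnorm qsq"
proof (intro ext)
  fix f :: "nat \<Rightarrow> 'a \<Rightarrow> real" and x
  define s where "s n = (\<Sum>i<n. (f (Suc i) x - f i x)\<^sup>2)" for n
  have s0: "0 \<le> s n" for n by (simp add: s_def sum_nonneg)
  have "incseq s" by (rule incseq_SucI) (simp add: s_def)
  let ?U = "\<Sum>i. ennreal ((f (Suc i) x - f i x)\<^sup>2)"
  have U: "?U = (SUP n. ennreal (s n))"
    unfolding s_def by (simp add: suminf_eq_SUP sum_ennreal)
  have fn: "fnorm qsq f x = (SUP n. ennreal (sqrt (s n)))"
    by (simp add: fnorm_def qsq_def L2_set_def s_def)
  show "sqf f x = fnorm qsq f x"
  proof (cases "?U = \<top>")
    case True
    have "fnorm qsq f x = \<top>"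
    proof (rule ccontr)
      assume "fnorm qsq f x \<noteq> \<top>"
      then obtain c where c: "0 \<le> c" "fnorm qsq f x = ennreal c"
        by (metis ennreal_cases)
      have "ennreal (s n) \<le> ennreal (c\<^sup>2)" for n
      proof (rule ennreal_leI)
        have "ennreal (sqrt (s n)) \<le> ennreal c" unfolding c(2)[symmetric] fn by (rule SUP_upper) simp
        then have "sqrt (s n) \<le> c" using c by simp
        then show "s n \<le> c\<^sup>2" using c by (simp add: sqrt_le_D)
      qed
      then have "?U \<le> ennreal (c\<^sup>2)" unfolding U by (intro SUP_least)
      then show False using True by (simp add: top_unique)
    qed
    then show ?thesis using True by (simp add: sqf_def epow_def)
  next
    case False
    define t where "t = enn2real ?U"
    have t: "?U = ennreal t" "0 \<le> t" using False by (simp_all add: t_def less_top)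
    have "(\<lambda>n. ennreal (s n)) \<longlonglongrightarrow> ennreal t"
      unfolding t(1)[symmetric] U using \<open>incseq s\<close>
      by (intro LIMSEQ_SUP) (auto simp: incseq_def intro: ennreal_leI)
    then have "s \<longlonglongrightarrow> t" using s0 t by (simp add: tendsto_ennreal_iff)
    then have "(\<lambda>n. ennreal (sqrt (s n))) \<longlonglongrightarrow> ennreal (sqrt t)" by (intro tendsto_ennrealI tendsto_real_sqrt)
    moreover have "(\<lambda>n. ennreal (sqrt (s n))) \<longlonglongrightarrow> fnorm qsq f x"
      unfolding fn using \<open>incseq s\<close>
      by (intro LIMSEQ_SUP) (auto simp: incseq_def intro: ennreal_leI)
    ultimately have "fnorm qsq f x = ennreal (sqrt t)" by (rule LIMSEQ_unique[rotated])
    then show ?thesis unfolding sqf_def t(1) using t(2) by (simp add: epow_def powr_half_sqrt)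
  qed
qed

section \<open>The Luxemburg functional and its bound by atomic decompositions\<close>

lemma phiE_mono:
  assumes "MO_function M \<phi>" "x \<in> space M" "u \<le> v"
  shows "phiE \<phi> x u \<le> phiE \<phi> x v"
proof (cases "v = \<top>")
  case False
  then have "u \<noteq> \<top>" "enn2real u \<le> enn2real v"
    using assms(3) by (auto simp: top_unique less_top intro: enn2real_mono)
  then show ?thesis using assms(1,2) False by (auto simp: phiE_def MO_function_def intro: ennreal_leI)
qed (simp add: phiE_def)

text \<open>Neither function need be measurable: the nonnegative integral is monotone for arbitrary
  integrands.\<close>

lemma lux_mono_AE:
  assumes MO: "MO_function M \<phi>" and le: "AE x in M. g x \<le> h x"
  shows "lux M \<phi> g \<le> lux M \<phi> h"
  unfolding lux_def
proof (rule Inf_superset_mono, safe)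
  fix l :: real
  assume l: "0 < l" "(\<integral>\<^sup>+ x. phiE \<phi> x (h x / ennreal l) \<partial>M) \<le> 1"
  have "(\<integral>\<^sup>+ x. phiE \<phi> x (g x / ennreal l) \<partial>M) \<le> (\<integral>\<^sup>+ x. phiE \<phi> x (h x / ennreal l) \<partial>M)"
    using le AE_space
    by (intro nn_integral_mono_AE, eventually_elim) (auto intro!: phiE_mono[OF MO] divide_right_mono_ennreal)
  with l show "\<exists>l'. ennreal l = ennreal l' \<and> 0 < l' \<and> (\<integral>\<^sup>+ x. phiE \<phi> x (g x / ennreal l') \<partial>M) \<le> 1"
    by (intro exI[of _ l]) auto
qed

text \<open>Where \<open>\<nu> k\<close> is infinite all conditional expectations of the atom
  vanish, so the atom bound extends to the whole space with an indicator. Countable subadditivity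
  and r \<le> 1 then give a pointwise bound with constant 1.\<close>

lemma (in trajectory_seminorm) lux_le_atq:
  assumes MO: "MO_function M \<phi>" and dec: "atdec M F \<phi> (fnorm q) f \<mu> a \<nu>" and r: "0 < r" "r \<le> 1"
  shows "lux M \<phi> (fnorm q f) \<le> atq M \<phi> r \<mu> \<nu>"
  unfolding atq_def
proof (rule lux_mono_AE[OF MO])
  let ?\<Lambda> = "\<lambda>k. lux M \<phi> (indicator (Bset M (\<nu> k)))"
  have \<mu>: "0 \<le> \<mu> k" and at: "atom M F \<phi> (fnorm q) (a k) (\<nu> k)" for k
    using dec by (auto simp: atdec_def)
  have sum: "AE x in M. \<forall>n. ((\<lambda>k. \<mu> k * condE M F n (a k) x) has_sum f n x) UNIV"
    using dec by (auto simp: atdec_def AE_all_countable)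
  have van: "AE x in M. \<forall>k n. enat n \<le> \<nu> k x \<longrightarrow> condE M F n (a k) x = 0"
    using at by (auto simp: atom_def AE_all_countable)
  have bnd: "AE x in M. \<forall>k. x \<in> Bset M (\<nu> k) \<longrightarrow> fnorm q (\<lambda>n. condE M F n (a k)) x \<le> inverse (?\<Lambda> k)"
    using at by (auto simp: atom_def AE_all_countable)
  show "AE x in M. fnorm q f x \<le> epow (\<Sum>\<^sub>\<infinity>k\<in>UNIV.
       epow (ennreal (\<mu> k) * indicator (Bset M (\<nu> k)) x / ?\<Lambda> k) r) (1 / r)"
    using sum van bnd AE_space
  proof eventually_elim
    case (elim x)
    have le: "fnorm q (\<lambda>n. condE M F n (a k)) x \<le> indicator (Bset M (\<nu> k)) x / ?\<Lambda> k" for k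
    proof (cases "x \<in> Bset M (\<nu> k)")
      case True
      then show ?thesis using elim(3) by (simp add: divide_ennreal_def)
    next
      case False
      then have "\<nu> k x = \<infinity>" using elim(4) by (simp add: Bset_def)
      then have "condE M F n (a k) x = 0" for n using elim(2) by simp
      then show ?thesis by (simp add: fnorm_def)
    qed
    have "fnorm q f x \<le> (\<Sum>\<^sub>\<infinity>k\<in>UNIV. ennreal (\<mu> k) * fnorm q (\<lambda>n. condE M F n (a k)) x)"
      unfolding fnorm_def using elim(1) \<mu> by (intro SUP_least q_has_sum_le) auto
    also have "\<dots> \<le> (\<Sum>\<^sub>\<infinity>k\<in>UNIV. ennreal (\<mu> k) * indicator (Bset M (\<nu> k)) x / ?\<Lambda> k)"
      using mult_left_mono[OF le] by (intro infsum_mono) (auto simp: ennreal_times_divide)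
    also have "\<dots> \<le> epow (\<Sum>\<^sub>\<infinity>k\<in>UNIV. epow (ennreal (\<mu> k) * indicator (Bset M (\<nu> k)) x / ?\<Lambda> k) r) (1 / r)"
      by (rule infsum_le_epow_infsum[OF r])
    finally show ?case .
  qed
qed

section \<open>Dyadic sums and Musielak--Orlicz functions of lower type\<close>

text \<open>From \<open>k0\<close> on the differences vanish; below it the bound makes them decay
  geometrically, which gives the absolute convergence required for an unordered sum and makes the
  lower end of the telescope 0.\<close>

lemma has_sum_telescope_int:
  fixes c :: "int \<Rightarrow> real"
  assumes top: "\<And>k. k0 \<le> k \<Longrightarrow> c k = L" and bnd: "\<And>k. \<bar>c k\<bar> \<le> A * 2 powr (of_int k)"
  shows "((\<lambda>k. c (k + 1) - c k) has_sum L) UNIV"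
proof -
  define d where "d j = c (k0 - int j)" for j
  have d: "\<bar>d j\<bar> \<le> A * 2 powr (of_int k0) * (1/2)^j" for j
    using bnd[of "k0 - int j"] by (simp add: d_def powr_diff powr_realpow power_one_over)
  have geo: "(\<lambda>j. A * 2 powr (of_int k0) * (1/2)^j) \<longlonglongrightarrow> 0"
    by (intro tendsto_mult_right_zero LIMSEQ_power_zero) simp
  have "d \<longlonglongrightarrow> 0"
    by (rule Lim_null_comparison[OF _ geo]) (use d in auto)
  then have "(\<lambda>n. d n - d (Suc n)) sums (d 0 - 0)" by (rule telescope_sums')
  moreover have "d 0 = L" by (simp add: d_def top)
  moreover have "summable (\<lambda>n. norm (d n - d (Suc n)))"
  proof (rule summable_comparison_test')
    show "summable (\<lambda>j. 2 * (A * 2 powr (of_int k0)) * (1/2)^j)"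
      by (intro summable_mult summable_geometric) simp
    fix n
    have "A * 2 powr (of_int k0) * (1/2)^n \<ge> 0" using d[of n] abs_ge_zero order_trans by blast
    then show "norm (norm (d n - d (Suc n))) \<le> 2 * (A * 2 powr (of_int k0)) * (1/2)^n"
      using d[of n] d[of "Suc n"] by simp
  qed
  ultimately have "((\<lambda>n. d n - d (Suc n)) has_sum L) UNIV"
    by (intro norm_summable_imp_has_sum) simp_all
  \<comment> \<open>The substitution k = k0 - n - 1 turns \<open>d n - d (Suc n)\<close> into
    \<open>c (k + 1) - c k\<close>.\<close>
  then have "((\<lambda>k. c (k + 1) - c k) \<circ> (\<lambda>n. k0 - int n - 1) has_sum L) UNIV"
    by (simp add: o_def d_def algebra_simps)
  then have "((\<lambda>k. c (k + 1) - c k) has_sum L) (range (\<lambda>n. k0 - int n - 1))"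
    by (subst has_sum_reindex) (auto simp: inj_on_def)
  moreover have "k \<in> range (\<lambda>n. k0 - int n - 1)" if "k < k0" for k
    using that by (intro range_eqI[of _ _ "nat (k0 - k - 1)"]) simp
  then have neutral: "c (k + 1) - c k = 0" if "k \<notin> range (\<lambda>n. k0 - int n - 1)" for k
    using that top[of k] top[of "k + 1"] by force
  have "((\<lambda>k. c (k + 1) - c k) has_sum L) UNIV \<longleftrightarrow>
      ((\<lambda>k. c (k + 1) - c k) has_sum L) (range (\<lambda>n. k0 - int n - 1))"
    by (rule has_sum_cong_neutral) (use neutral in auto)
  ultimately show ?thesis by blast
qed

lemma infsum_ennreal_eq:
  fixes g :: "'b \<Rightarrow> real"
  assumes "(g has_sum x) A" "\<And>k. k \<in> A \<Longrightarrow> 0 \<le> g k"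
  shows "(\<Sum>\<^sub>\<infinity>k\<in>A. ennreal (g k)) = ennreal x"
proof (rule infsumI)
  have "((\<lambda>K. ennreal (sum g K)) \<longlongrightarrow> ennreal x) (finite_subsets_at_top A)"
    using assms(1) unfolding has_sum_def by (rule tendsto_ennrealI)
  moreover have "eventually (\<lambda>K. ennreal (sum g K) = (\<Sum>k\<in>K. ennreal (g k))) (finite_subsets_at_top A)"
    using assms(2) by (intro eventually_finite_subsets_at_top_weakI) (auto simp: sum_ennreal subset_iff)
  ultimately show "((\<lambda>k. ennreal (g k)) has_sum ennreal x) A"
    unfolding has_sum_def by (rule Lim_transform_eventually)
qed

text \<open>Enumerating the integers turns these unordered sums into series, so that monotone
  convergence for series applies to them.\<close>

lemma infsum_int_ennreal:
  fixes u :: "int \<Rightarrow> ennreal"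
  shows "(\<Sum>\<^sub>\<infinity>k\<in>UNIV. u k) = (\<Sum>j. u (int_decode j))"
proof -
  have "(u has_sum (\<Sum>\<^sub>\<infinity>k\<in>UNIV. u k)) UNIV" by simp
  then have "((\<lambda>j. u (int_decode j)) has_sum (\<Sum>\<^sub>\<infinity>k\<in>UNIV. u k)) UNIV"
    using has_sum_reindex_bij_betw[OF bij_int_decode] by blast
  then show ?thesis by (intro sums_unique has_sum_imp_sums)
qed

lemma nn_integral_infsum_int:
  fixes u :: "int \<Rightarrow> 'a \<Rightarrow> ennreal"
  assumes "\<And>k. u k \<in> borel_measurable M"
  shows "(\<integral>\<^sup>+x. (\<Sum>\<^sub>\<infinity>k\<in>UNIV. u k x) \<partial>M) = (\<Sum>\<^sub>\<infinity>k\<in>UNIV. \<integral>\<^sup>+x. u k x \<partial>M)"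
  unfolding infsum_int_ennreal by (rule nn_integral_suminf) (rule assms)

lemma infsum_int_cmult_ennreal:
  fixes u :: "int \<Rightarrow> ennreal"
  shows "(\<Sum>\<^sub>\<infinity>k\<in>UNIV. c * u k) = c * (\<Sum>\<^sub>\<infinity>k\<in>UNIV. u k)"
  unfolding infsum_int_ennreal by simp

lemma infsum_mono_ennreal:
  fixes u v :: "'b \<Rightarrow> ennreal"
  assumes "\<And>k. k \<in> A \<Longrightarrow> u k \<le> v k"
  shows "infsum u A \<le> infsum v A"
  by (rule infsum_mono) (auto intro: assms)

lemma infsum_ge_ennreal:
  fixes u :: "'b \<Rightarrow> ennreal"
  shows "k \<in> A \<Longrightarrow> u k \<le> infsum u A"
  using sum_le_infsum_ennreal[of "{k}" A u] by simp

text \<open>With k0 the integer part of log 2 t the condition reads k \<le> k0, and 2^k0 \<le> t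
  bounds the term at k by the (k0 - k)-th power of 2^-s.\<close>

lemma dyadic_geometric_bound:
  fixes s t :: real
  assumes s: "0 < s" and t: "0 < t"
  shows "(\<Sum>\<^sub>\<infinity>k\<in>UNIV. if 2 powr (of_int k) \<le> t then ennreal ((2 powr (of_int k) / t) powr s) else 0)
     \<le> ennreal (1 / (1 - 2 powr (- s)))"
proof -
  define k0 where "k0 = \<lfloor>log 2 t\<rfloor>"
  define z where "z = (2::real) powr (- s)"
  have z: "0 < z" "z < 1" using s by (auto simp: z_def powr_less_one)
  have k_iff: "2 powr (of_int k) \<le> t \<longleftrightarrow> k \<le> k0" for k
    using t by (simp add: k0_def le_floor_iff le_log_iff)
  have "(\<lambda>j. z ^ j) sums (1 / (1 - z))" using z by (intro geometric_sums) simp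
  then have "((\<lambda>j. z ^ j) has_sum (1 / (1 - z))) UNIV"
    using z by (intro sums_nonneg_imp_has_sum) auto
  then have "((\<lambda>k. z ^ nat (k0 - k)) \<circ> (\<lambda>j. k0 - int j) has_sum (1 / (1 - z))) UNIV"
    by (simp add: o_def)
  then have "((\<lambda>k. z ^ nat (k0 - k)) has_sum (1 / (1 - z))) (range (\<lambda>j. k0 - int j))"
    by (subst has_sum_reindex) (auto simp: inj_on_def)
  moreover have "range (\<lambda>j. k0 - int j) = {..k0}"
  proof safe
    fix k assume "k \<le> k0"
    then show "k \<in> range (\<lambda>j. k0 - int j)" by (intro range_eqI[of _ _ "nat (k0 - k)"]) simp
  qed simp
  ultimately have "((\<lambda>k. z ^ nat (k0 - k)) has_sum (1 / (1 - z))) {..k0}" by simp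
  then have geo: "(\<Sum>\<^sub>\<infinity>k\<in>{..k0}. ennreal (z ^ nat (k0 - k))) = ennreal (1 / (1 - z))"
    using z by (intro infsum_ennreal_eq) auto
  have "(2 powr (of_int k) / t) powr s \<le> z ^ nat (k0 - k)" if "k \<le> k0" for k
  proof -
    have "2 powr (of_int k0) \<le> t" using k_iff[of k0] by simp
    then have "2 powr (of_int k) / t \<le> 2 powr (of_int k) / 2 powr (of_int k0)"
      using t by (intro divide_left_mono) auto
    then have "(2 powr (of_int k) / t) powr s \<le> (2 powr (of_int k - of_int k0)) powr s"
      using s t by (intro powr_mono2) (auto simp: powr_diff)
    also have "\<dots> = z powr (real (nat (k0 - k)))"
      using that by (simp add: z_def powr_powr algebra_simps)
    also have "\<dots> = z ^ nat (k0 - k)" using z by (simp add: powr_realpow)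
    finally show ?thesis .
  qed
  then have "(\<Sum>\<^sub>\<infinity>k\<in>UNIV. if 2 powr (of_int k) \<le> t then ennreal ((2 powr (of_int k) / t) powr s) else 0)
     \<le> (\<Sum>\<^sub>\<infinity>k\<in>UNIV. if k \<le> k0 then ennreal (z ^ nat (k0 - k)) else 0)"
    unfolding k_iff by (intro infsum_mono_ennreal) (auto intro: ennreal_leI)
  also have "\<dots> = (\<Sum>\<^sub>\<infinity>k\<in>{..k0}. ennreal (z ^ nat (k0 - k)))"
    by (rule infsum_cong_neutral) auto
  finally show ?thesis using geo by (simp add: z_def)
qed

section \<open>Luxemburg quasi-norms of indicators\<close>

locale mo_lower_type = prob_space M for M :: "'a measure" +
  fixes \<phi> :: "'a \<Rightarrow> real \<Rightarrow> real" and p C :: real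
  assumes MO: "MO_function M \<phi>" and p: "0 < p" and C: "0 < C"
    and lower: "\<And>x t s. x \<in> space M \<Longrightarrow> 0 \<le> t \<Longrightarrow> 0 < s \<Longrightarrow> s < 1 \<Longrightarrow> \<phi> x (s * t) \<le> C * s powr p * \<phi> x t"
begin

lemma phi_mono: "x \<in> space M \<Longrightarrow> 0 \<le> s \<Longrightarrow> s \<le> t \<Longrightarrow> \<phi> x s \<le> \<phi> x t"
  using MO by (auto simp: MO_function_def)

lemma phi_0: "x \<in> space M \<Longrightarrow> \<phi> x 0 = 0"
  using MO by (auto simp: MO_function_def)

lemma phi_nonneg: "x \<in> space M \<Longrightarrow> 0 \<le> t \<Longrightarrow> 0 \<le> \<phi> x t"
  using phi_mono[of x 0 t] phi_0 by simp

lemma phi_pos: "x \<in> space M \<Longrightarrow> 0 < t \<Longrightarrow> 0 < \<phi> x t"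
  using MO by (auto simp: MO_function_def)

lemma phi_integrable: "0 \<le> t \<Longrightarrow> integrable M (\<lambda>x. \<phi> x t)"
  using MO by (auto simp: MO_function_def)

lemma phi_measurable: "0 \<le> t \<Longrightarrow> (\<lambda>x. \<phi> x t) \<in> borel_measurable M"
  using phi_integrable by auto

lemma lux_le:
  assumes "0 < l" "(\<integral>\<^sup>+ x. phiE \<phi> x (g x / ennreal l) \<partial>M) \<le> 1"
  shows "lux M \<phi> g \<le> ennreal l"
  unfolding lux_def using assms by (intro Inf_lower) auto

lemma phiE_indicator:
  assumes "x \<in> space M" "0 < l"
  shows "phiE \<phi> x (indicator B x / ennreal l) = ennreal (\<phi> x (1 / l)) * indicator B x"
proof -
  have "1 / ennreal l = ennreal (1 / l)" using assms by (simp add: divide_ennreal[symmetric])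
  then show ?thesis using assms by (auto simp: phiE_def phi_0 split: split_indicator)
qed

text \<open>Lower type makes the integral of \<phi>(x, \<epsilon>) at most C \<epsilon>^p times that
  of \<phi>(x, 1), hence at most 1 for small \<open>\<epsilon>\<close>.\<close>

lemma lux_indicator_finite: "lux M \<phi> (indicator B) < \<top>"
proof -
  define J where "J = (\<integral>x. \<phi> x 1 \<partial>M)"
  have "0 \<le> J" unfolding J_def using phi_nonneg by (intro integral_nonneg_AE) auto
  \<comment> \<open>Solves \<epsilon>^p = 1 / (C J + 2); the 2 keeps the base above 1, so that
    \<epsilon> < 1 whatever the value of C J.\<close>
  define \<epsilon> where "\<epsilon> = (C * J + 2) powr (- 1 / p)"
  have CJ: "0 \<le> C * J" using C \<open>0 \<le> J\<close> by simp
  have \<epsilon>: "0 < \<epsilon>" "\<epsilon> < 1" "\<epsilon> powr p = 1 / (C * J + 2)"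
  proof -
    show "0 < \<epsilon>" using CJ by (simp add: \<epsilon>_def)
    have "\<epsilon> < (C * J + 2) powr 0" unfolding \<epsilon>_def using CJ p by (intro powr_less_mono) auto
    then show "\<epsilon> < 1" using CJ by simp
    show "\<epsilon> powr p = 1 / (C * J + 2)"
      unfolding \<epsilon>_def powr_powr using CJ p by (simp add: powr_minus_divide)
  qed
  have "(\<integral>\<^sup>+ x. phiE \<phi> x (indicator B x / ennreal (1 / \<epsilon>)) \<partial>M) \<le> (\<integral>\<^sup>+ x. ennreal (C * \<epsilon> powr p * \<phi> x 1) \<partial>M)"
  proof (rule nn_integral_mono)
    fix x assume x: "x \<in> space M"
    have "phiE \<phi> x (indicator B x / ennreal (1 / \<epsilon>)) \<le> ennreal (\<phi> x \<epsilon>)"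
      using x \<epsilon> by (auto simp: phiE_indicator split: split_indicator)
    also have "\<dots> \<le> ennreal (C * \<epsilon> powr p * \<phi> x 1)"
      using lower[OF x, of 1 \<epsilon>] \<epsilon> by (intro ennreal_leI) auto
    finally show "phiE \<phi> x (indicator B x / ennreal (1 / \<epsilon>)) \<le> ennreal (C * \<epsilon> powr p * \<phi> x 1)" .
  qed
  also have "\<dots> = ennreal (\<integral>x. C * \<epsilon> powr p * \<phi> x 1 \<partial>M)"
    using phi_integrable[of 1] phi_nonneg C
    by (intro nn_integral_eq_integral integrable_mult_right AE_I2 mult_nonneg_nonneg) auto
  also have "\<dots> = ennreal (C * J / (C * J + 2))" by (simp add: J_def \<epsilon>(3)[unfolded J_def])
  also have "\<dots> \<le> 1" using CJ by (intro ennreal_le_1[THEN iffD2]) (simp add: divide_le_eq)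
  finally have "lux M \<phi> (indicator B) \<le> ennreal (1 / \<epsilon>)"
    using \<epsilon> by (intro lux_le) auto
  then show ?thesis by (rule le_less_trans) simp
qed

text \<open>A vanishing quasi-norm bounds the integral of \<phi>(x, n) over \<open>B\<close> by 1
  for every n. By monotone convergence the supremum over n is finite almost everywhere on
  \<open>B\<close>, whereas \<phi>(x, n) tends to infinity.\<close>

lemma lux_indicator_eq_0:
  assumes [measurable]: "B \<in> sets M" and 0: "lux M \<phi> (indicator B) = 0"
  shows "AE x in M. x \<notin> B"
proof -
  let ?g = "\<lambda>n x. ennreal (\<phi> x (real n)) * indicator B x"
  have [measurable]: "(\<lambda>x. \<phi> x (real n)) \<in> borel_measurable M" for n by (rule phi_measurable) simp
  have bnd: "(\<integral>\<^sup>+x. ?g n x \<partial>M) \<le> 1" for n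
  proof (cases "n = 0")
    case False
    have "lux M \<phi> (indicator B) < ennreal (1 / real n)" using 0 False by simp
    then obtain l where l: "0 < l" "(\<integral>\<^sup>+ x. phiE \<phi> x (indicator B x / ennreal l) \<partial>M) \<le> 1"
        "ennreal l < ennreal (1 / real n)"
      unfolding lux_def Inf_less_iff by blast
    then have "l < 1 / real n" by (simp add: ennreal_less_iff)
    then have nl: "real n \<le> 1 / l" using l(1) False by (simp add: field_simps)
    have "(\<integral>\<^sup>+x. ?g n x \<partial>M) \<le> (\<integral>\<^sup>+ x. phiE \<phi> x (indicator B x / ennreal l) \<partial>M)"
      using nl l(1) by (intro nn_integral_mono) (auto simp: phiE_indicator split: split_indicator intro!: ennreal_leI phi_mono)
    with l(2) show ?thesis by simp
  qed (simp add: phi_0 cong: nn_integral_cong)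
  have "(\<integral>\<^sup>+x. (SUP n. ?g n x) \<partial>M) = (SUP n. \<integral>\<^sup>+x. ?g n x \<partial>M)"
  proof (rule nn_integral_monotone_convergence_SUP_AE)
    show "AE x in M. ?g i x \<le> ?g (Suc i) x" for i
      by (rule AE_I2) (auto split: split_indicator intro!: ennreal_leI phi_mono)
  qed auto
  also have "\<dots> \<le> 1" using bnd by (intro SUP_least)
  finally have "(\<integral>\<^sup>+x. (SUP n. ?g n x) \<partial>M) \<noteq> \<infinity>" by (auto simp: top_unique)
  then have "AE x in M. (SUP n. ?g n x) \<noteq> \<infinity>" by (intro nn_integral_PInf_AE) auto
  then show ?thesis using AE_space
  proof eventually_elim
    case (elim x)
    show ?case
    proof
      assume x: "x \<in> B"
      have "filterlim (\<phi> x) at_top at_top" using MO elim by (auto simp: MO_function_def)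
      then have lim: "filterlim (\<lambda>n. \<phi> x (real n)) at_top sequentially"
        by (rule filterlim_compose) (rule filterlim_real_sequentially)
      obtain b where b: "(SUP n. ?g n x) = ennreal b" "0 \<le> b"
        using elim(1) by (cases "SUP n. ?g n x" rule: ennreal_cases) auto
      have "eventually (\<lambda>n. b + 1 \<le> \<phi> x (real n)) sequentially"
        using lim by (simp add: filterlim_at_top)
      then obtain n where n: "b + 1 \<le> \<phi> x (real n)" by (auto simp: eventually_sequentially)
      have "ennreal (\<phi> x (real n)) \<le> ennreal b"
        unfolding b(1)[symmetric] using x by (intro SUP_upper2[of n]) auto
      then show False using n b(2) by (simp add: ennreal_le_iff)
    qed
  qed
qed

end

section \<open>Atomic decomposition\<close>

lemma (in filtered_prob) martingale_diff:
  assumes f: "martingale M F f" and g: "martingale M F g"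
  shows "martingale M F (\<lambda>n x. f n x - g n x)"
  unfolding martingale_def
proof (intro allI conjI)
  fix n
  show "integrable M (\<lambda>x. f n x - g n x)"
    by (intro Bochner_Integration.integrable_diff martingaleD[OF f] martingaleD[OF g])
  show "(\<lambda>x. f n x - g n x) \<in> borel_measurable (F n)"
    by (intro borel_measurable_diff martingaleD[OF f] martingaleD[OF g])
  have "AE x in M. condE M F n (\<lambda>x. f (Suc n) x - g (Suc n) x) x
      = condE M F n (f (Suc n)) x - condE M F n (g (Suc n)) x"
    by (intro CE.real_cond_exp_diff martingaleD[OF f] martingaleD[OF g])
  then show "AE x in M. condE M F n (\<lambda>x. f (Suc n) x - g (Suc n) x) x = f n x - g n x"
    using martingaleD(4)[OF f, of n] martingaleD(4)[OF g, of n] by eventually_elim simp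
qed

text \<open>Summing the increments costs a factor growing with n. The bound is used only at a fixed
  time: for integrability of squares and for the decay in k of stopped values.\<close>

lemma (in trajectory_seminorm) abs_le_q:
  assumes "u 0 = 0"
  shows "\<bar>u n\<bar> \<le> 2 * real n * q n u"
proof (induction n)
  case (Suc n)
  have "\<bar>u (Suc n)\<bar> \<le> \<bar>u n\<bar> + \<bar>u (Suc n) - u n\<bar>" by linarith
  also have "\<dots> \<le> 2 * real n * q n u + 2 * q (Suc n) u"
    using Suc.IH increment[of u n] by linarith
  also have "\<dots> \<le> 2 * real n * q (Suc n) u + 2 * q (Suc n) u"
    using mono[of n "Suc n" u] by (intro add_right_mono mult_left_mono) auto
  finally show ?case by (simp add: algebra_simps)
qed (simp add: assms)

text \<open>Applied to the indices k for which \<open>Bset M (time f k)\<close> contains a given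
  point: nestedness gives \<open>down\<close>, and the last index dominates the sum over k.\<close>

lemma dyadic_last_index:
  fixes S :: "int set"
  assumes down: "\<And>k. k + 1 \<in> S \<Longrightarrow> k \<in> S" and "k \<in> S" "k' \<notin> S"
  obtains m where "m \<in> S" "\<And>k. k \<in> S \<Longrightarrow> k \<le> m"
proof -
  have down': "k - int j \<in> S" if "k \<in> S" for k j
  proof (induction j)
    case (Suc j)
    then show ?case using down[of "k - int (Suc j)"] by (simp add: algebra_simps)
  qed (use that in simp)
  have lt: "i < k'" if "i \<in> S" for i
  proof (rule ccontr)
    assume "\<not> i < k'"
    then show False using down'[OF that, of "nat (i - k')"] \<open>k' \<notin> S\<close> by simp
  qed
  have "\<exists>m\<in>S. m + 1 \<notin> S"
  proof (rule ccontr)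
    assume "\<not> ?thesis"
    then have up: "i + 1 \<in> S" if "i \<in> S" for i using that by blast
    have "k + int j \<in> S" for j
    proof (induction j)
      case (Suc j)
      then show ?case using up[of "k + int j"] by (simp add: algebra_simps)
    qed (use \<open>k \<in> S\<close> in simp)
    from lt[OF this[of "nat (k' - k)"]] lt[OF \<open>k \<in> S\<close>] show False by simp
  qed
  then obtain m where m: "m \<in> S" "m + 1 \<notin> S" by blast
  have "i \<le> m" if "i \<in> S" for i
  proof (rule ccontr)
    assume "\<not> i \<le> m"
    then show False using down'[OF that, of "nat (i - (m + 1))"] m by simp
  qed
  with m(1) show thesis by (rule that)
qed

text \<open>\<open>S_minus\<close> is the inequality of the class S^- with its constant moved to the
  other side, and \<open>covers\<close> is the conclusion of \<open>regular_cover\<close>.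
  \<open>q_measurable\<close> refers to the times up to \<open>n\<close> only, so the truncations of
  an adapted sequence are adapted.\<close>

locale atomic_setting =
  filtered_prob M F + mo_lower_type M \<phi> p C + trajectory_seminorm q
  for M :: "'a measure" and F \<phi> p C q +
  fixes K R :: real
  assumes K: "0 < K" and R: "0 < R"
    and S_minus: "\<And>t n. 0 \<le> t \<Longrightarrow>
      AE x in M. condE M F n (\<lambda>y. \<phi> y t) x \<le> K * condE M F (Suc n) (\<lambda>y. \<phi> y t) x"
    and covers: "\<And>n D. D \<in> sets (F (Suc n)) \<Longrightarrow> AE x in M. x \<in> D \<longrightarrow> x \<in> cover R n D"
    and q_measurable: "\<And>n g (N :: 'a measure). (\<And>i. i \<le> n \<Longrightarrow> g i \<in> borel_measurable N) \<Longrightarrow>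
      (\<lambda>x. q n (\<lambda>i. g i x)) \<in> borel_measurable N"
begin

text \<open>In the first case of \<open>square\<close> the martingale itself is bounded by
  \<open>b\<close>; in the second its second moments are controlled by the sum of squared
  increments. Either way they are at most b^2.\<close>

lemma q_bounded_martingale_closed:
  assumes g: "martingale M F g" and g0: "AE x in M. g 0 x = 0"
    and b: "AE x in M. \<forall>n. q n (\<lambda>i. g i x) \<le> b"
  obtains a where "integrable M a" "\<And>n. AE x in M. condE M F n a x = g n x"
proof -
  have [measurable]: "g n \<in> borel_measurable M" for n by (rule martingaleD[OF g])
  \<comment> \<open>The bound used here grows with \<open>n\<close> and serves integrability
    only.\<close>
  have sq: "integrable M (\<lambda>x. (g n x)\<^sup>2)" for n
  proof (rule integrable_const_bound)
    show "AE x in M. norm ((g n x)\<^sup>2) \<le> (2 * real n * b)\<^sup>2"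
      using g0 b
    proof eventually_elim
      case (elim x)
      have "\<bar>g n x\<bar> \<le> 2 * real n * q n (\<lambda>i. g i x)" using elim by (intro abs_le_q)
      also have "\<dots> \<le> 2 * real n * b" using elim by (intro mult_left_mono) auto
      finally show ?case by (simp add: abs_le_square_iff[symmetric])
    qed
  qed auto
  have "(\<integral>x. (g n x)\<^sup>2 \<partial>M) \<le> b\<^sup>2" for n
    using square
  proof
    assume le: "\<forall>n u. \<bar>u n\<bar> \<le> q n u"
    have "(\<integral>x. (g n x)\<^sup>2 \<partial>M) \<le> (\<integral>x. b\<^sup>2 \<partial>M)"
    proof (rule integral_mono_AE[OF sq])
      show "AE x in M. (g n x)\<^sup>2 \<le> b\<^sup>2"
        using b
      proof eventually_elim
        case (elim x)
        have "\<bar>g n x\<bar> \<le> b" using le[rule_format, of "\<lambda>i. g i x" n] elim by (meson order_trans)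
        then show ?case by (simp add: abs_le_square_iff[symmetric])
      qed
    qed simp
    then show ?thesis by (simp add: prob_space)
  next
    assume le: "\<forall>n u. (\<Sum>i<n. (u (Suc i) - u i)\<^sup>2) \<le> (q n u)\<^sup>2"
    have "(\<integral>x. (g n x)\<^sup>2 \<partial>M) = (\<integral>x. (g 0 x)\<^sup>2 \<partial>M) + (\<integral>x. (\<Sum>i<n. (g (Suc i) x - g i x)\<^sup>2) \<partial>M)"
      by (rule martingale_square_sum[OF g sq])
    also have "(\<integral>x. (g 0 x)\<^sup>2 \<partial>M) = 0"
      using g0 by (intro integral_eq_zero_AE) auto
    also have "(\<integral>x. (\<Sum>i<n. (g (Suc i) x - g i x)\<^sup>2) \<partial>M) \<le> (\<integral>x. b\<^sup>2 \<partial>M)"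
    proof (rule integral_mono_AE)
      show "AE x in M. (\<Sum>i<n. (g (Suc i) x - g i x)\<^sup>2) \<le> b\<^sup>2"
        using b
      proof eventually_elim
        case (elim x)
        have "(\<Sum>i<n. (g (Suc i) x - g i x)\<^sup>2) \<le> (q n (\<lambda>i. g i x))\<^sup>2"
          using le[rule_format, where u = "\<lambda>i. g i x"] by simp
        also have "\<dots> \<le> b\<^sup>2" using elim nonneg by (intro power_mono) auto
        finally show ?case .
      qed
    qed (auto intro!: martingale_orthogonal[OF g sq])
    finally show ?thesis by (simp add: prob_space)
  qed
  then obtain a where "integrable M a" "\<And>n. AE x in M. condE M F n a x = g n x"
    using martingale_L2_bounded_closed[OF g sq] by blast
  then show thesis by (rule that)
qed

section \<open>Level sets and anticipating stopping times\<close>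

definition level :: "(nat \<Rightarrow> 'a \<Rightarrow> real) \<Rightarrow> int \<Rightarrow> nat \<Rightarrow> 'a set" where
  "level f k n = {x \<in> space M. 2 powr (of_int k) < q (Suc n) (\<lambda>i. f i x)}"

text \<open>
  Since the level sets at time \<open>Suc n\<close> are covered by the \<open>F n\<close>-measurable sets \<open>cover R n (level f k n)\<close>,
  the entry time of the latter strictly precedes the first passage above \<open>2\<^sup>k\<close>.
\<close>

definition time :: "(nat \<Rightarrow> 'a \<Rightarrow> real) \<Rightarrow> int \<Rightarrow> 'a \<Rightarrow> enat" where
  "time f k = entry (\<lambda>n. cover R n (level f k n))"

lemma Bset_time: "Bset M (time f k) = (\<Union>n. cover R n (level f k n))"
  unfolding Bset_def time_def entry_less_top_iff by (auto simp: cover_def)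

lemma Bset_time_measurable: "Bset M (time f k) \<in> sets M"
  unfolding Bset_time using sets_F_M[OF cover_sets] by blast

lemma stopping_time: "stopping M F (time f k)"
  unfolding time_def by (intro stopping_entry cover_sets)

context
  fixes f :: "nat \<Rightarrow> 'a \<Rightarrow> real"
  assumes f: "martingale M F f" and f0: "AE x in M. f 0 x = 0"
begin

lemma level_sets: "level f k n \<in> sets (F (Suc n))"
proof -
  have [measurable]: "(\<lambda>x. q (Suc n) (\<lambda>i. f i x)) \<in> borel_measurable (F (Suc n))"
    by (intro q_measurable measurable_F_mono[OF martingaleD(2)[OF f]])
  have "{x \<in> space (F (Suc n)). 2 powr (of_int k) < q (Suc n) (\<lambda>i. f i x)} \<in> sets (F (Suc n))"
    by measurable
  then show ?thesis unfolding level_def space_F .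
qed

lemma fnorm_level:
  assumes "x \<in> level f k n"
  shows "ennreal (2 powr (of_int k)) < fnorm q f x"
proof -
  have "ennreal (2 powr (of_int k)) < ennreal (q (Suc n) (\<lambda>i. f i x))"
    using assms by (simp add: level_def ennreal_less_iff)
  also have "\<dots> \<le> fnorm q f x" unfolding fnorm_def by (rule SUP_upper) simp
  finally show ?thesis .
qed

text \<open>Nestedness of the covers makes the stopping times nondecreasing in k. Conditional
  expectations are monotone only up to null sets, hence the exceptional set.\<close>

lemma time_Suc_AE: "AE x in M. \<forall>k n. x \<in> cover R n (level f (k + 1) n) \<longrightarrow> x \<in> cover R n (level f k n)"
  unfolding AE_all_countable
proof (intro allI)
  fix k n
  have "level f (k + 1) n \<subseteq> level f k n"
  proof -
    have "(2::real) powr (of_int k) \<le> 2 powr (of_int (k + 1))" by (intro powr_mono) auto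
    then show ?thesis unfolding level_def by (blast intro: le_less_trans)
  qed
  then show "AE x in M. x \<in> cover R n (level f (k + 1) n) \<longrightarrow> x \<in> cover R n (level f k n)"
    by (rule cover_antimono[OF _ level_sets level_sets])
qed

text \<open>The bound includes the stopping time itself: for n = m + 1 \<le>
  \<open>time f k x\<close> the point avoids the cover at time m, hence also the level set inside
  it, which is the event of exceeding 2^k at time m + 1.\<close>

lemma q_before_time_AE: "AE x in M. \<forall>k n. enat n \<le> time f k x \<longrightarrow> q n (\<lambda>i. f i x) \<le> 2 powr (of_int k)"
proof -
  have "AE x in M. \<forall>k n. x \<in> level f k n \<longrightarrow> x \<in> cover R n (level f k n)"
    unfolding AE_all_countable using covers[OF level_sets] by blast
  then show ?thesis using f0 AE_space
  proof eventually_elim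
    case (elim x)
    show ?case
    proof (intro allI impI)
      fix k n assume t: "enat n \<le> time f k x"
      show "q n (\<lambda>i. f i x) \<le> 2 powr (of_int k)"
      proof (cases n)
        \<comment> \<open>No cover precedes time 0; here \<open>f 0 x = 0\<close> and
          \<open>zero\<close> give the value 0.\<close>
        case 0
        then show ?thesis using elim(2) by (simp add: zero)
      next
        case (Suc m)
        then have "x \<notin> cover R m (level f k m)" using t by (simp add: time_def le_entry_iff)
        then have "x \<notin> level f k m" using elim(1) by blast
        then show ?thesis using elim(3) Suc by (simp add: level_def)
      qed
    qed
  qed
qed

lemma time_weight_bound:
  assumes "0 \<le> t"
  shows "(\<integral>\<^sup>+x. ennreal (\<phi> x t) * indicator (Bset M (time f k)) x \<partial>M)
    \<le> ennreal (R * K) * (\<integral>\<^sup>+x. ennreal (\<phi> x t) * indicator (\<Union>n. level f k n) x \<partial>M)"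
  unfolding Bset_time
  using assms by (intro cover_weight_bound R K phi_integrable phi_nonneg S_minus level_sets)

text \<open>
  The lower type \<open>p\<close> makes the terms of the dyadic sum below \<open>T f\<close> decay geometrically, so that the sum
  is controlled by its last term; \<open>\<epsilon>\<close> absorbs all constants.
\<close>

lemma level_sum_le:
  assumes x: "x \<in> space M" and l: "0 < l" and \<epsilon>: "0 < \<epsilon>" "\<epsilon> < 1"
    and small: "R * K * C / (1 - 2 powr (- p)) * \<epsilon> powr p \<le> 1"
  shows "ennreal (R * K) * (\<Sum>\<^sub>\<infinity>k\<in>UNIV. ennreal (\<phi> x (\<epsilon> * 2 powr (of_int k) / l)) * indicator (\<Union>n. level f k n) x)
     \<le> phiE \<phi> x (fnorm q f x / ennreal l)"
proof (cases "fnorm q f x = \<top>")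
  case True
  then show ?thesis using l by (simp add: phiE_def ennreal_top_divide)
next
  case False
  define t where "t = enn2real (fnorm q f x)"
  have ft: "fnorm q f x = ennreal t" "0 \<le> t" using False by (simp_all add: t_def less_top)
  define Z where "Z = 1 / (1 - (2::real) powr (- p))"
  have Z: "0 < Z" using p by (simp add: Z_def powr_less_one)
  have rhs: "phiE \<phi> x (fnorm q f x / ennreal l) = ennreal (\<phi> x (t / l))"
    using l ft by (simp add: phiE_def divide_ennreal)
  have lt: "2 powr (of_int k) < t" if "x \<in> level f k n" for k n
    using fnorm_level[OF that] by (simp add: ft ennreal_less_iff)
  show ?thesis
  proof (cases "t = 0")
    case True
    have "2 powr (of_int k) > (0::real)" for k by simp
    then have "x \<notin> level f k n" for k n using lt[of k n] True by (meson less_asym)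
    then show ?thesis by simp
  next
    case False
    then have t: "0 < t" using ft by simp
    define Q where "Q = C * \<epsilon> powr p * \<phi> x (t / l)"
    have Q: "0 \<le> Q" using C phi_nonneg[OF x, of "t / l"] t l by (simp add: Q_def)
    have "ennreal (\<phi> x (\<epsilon> * 2 powr (of_int k) / l)) * indicator (\<Union>n. level f k n) x
       \<le> ennreal Q * (if 2 powr (of_int k) \<le> t then ennreal ((2 powr (of_int k) / t) powr p) else 0)" for k
    proof (cases "x \<in> (\<Union>n. level f k n)")
      case True
      then have k: "2 powr (of_int k) < t" using lt by blast
      \<comment> \<open>With this factor \<epsilon> 2^k / l = s (t / l), and s < 1 because
        \<epsilon> < 1 and 2^k < t; lower type then compares with \<phi>(x, t / l).\<close>
      let ?s = "\<epsilon> * (2 powr (of_int k) / t)"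
      have s: "0 < ?s" "?s < 1"
      proof -
        show "0 < ?s" using \<epsilon> t by simp
        have "2 powr (of_int k) / t < 1" using k t by simp
        then show "?s < 1" using \<epsilon> t mult_strict_mono[of \<epsilon> 1 "2 powr (of_int k) / t" 1] by simp
      qed
      have "\<phi> x (\<epsilon> * 2 powr (of_int k) / l) = \<phi> x (?s * (t / l))" using t by simp
      also have "\<dots> \<le> C * ?s powr p * \<phi> x (t / l)" using s t l by (intro lower x) auto
      also have "?s powr p = \<epsilon> powr p * (2 powr (of_int k) / t) powr p"
        using \<epsilon> t by (intro powr_mult)
      finally have "\<phi> x (\<epsilon> * 2 powr (of_int k) / l) \<le> Q * (2 powr (of_int k) / t) powr p"
        by (simp add: Q_def mult_ac)
      then have "ennreal (\<phi> x (\<epsilon> * 2 powr (of_int k) / l)) \<le> ennreal Q * ennreal ((2 powr (of_int k) / t) powr p)"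
        using Q by (simp add: ennreal_mult[symmetric] ennreal_leI)
      then show ?thesis using True k by simp
    qed simp
    then have "(\<Sum>\<^sub>\<infinity>k\<in>UNIV. ennreal (\<phi> x (\<epsilon> * 2 powr (of_int k) / l)) * indicator (\<Union>n. level f k n) x)
      \<le> ennreal Q * (\<Sum>\<^sub>\<infinity>k\<in>UNIV. if 2 powr (of_int k) \<le> t then ennreal ((2 powr (of_int k) / t) powr p) else 0)"
      unfolding infsum_int_cmult_ennreal[symmetric] by (intro infsum_mono_ennreal)
    also have "\<dots> \<le> ennreal Q * ennreal Z"
      unfolding Z_def by (intro mult_left_mono dyadic_geometric_bound p t) simp
    finally have "ennreal (R * K) * (\<Sum>\<^sub>\<infinity>k\<in>UNIV. ennreal (\<phi> x (\<epsilon> * 2 powr (of_int k) / l)) * indicator (\<Union>n. level f k n) x)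
      \<le> ennreal (R * K) * (ennreal Q * ennreal Z)" by (rule mult_left_mono) simp
    also have "\<dots> = ennreal (R * K * (Q * Z))" using Q Z R K by (simp add: ennreal_mult)
    also have "R * K * (Q * Z) = (R * K * C / (1 - 2 powr (- p)) * \<epsilon> powr p) * \<phi> x (t / l)"
      by (simp add: Q_def Z_def)
    also have "ennreal \<dots> \<le> ennreal (1 * \<phi> x (t / l))"
      using phi_nonneg[OF x, of "t / l"] t l by (intro ennreal_leI mult_right_mono small) auto
    finally show ?thesis by (simp add: rhs)
  qed
qed

text \<open>For each k the weight of \<open>Bset M (time f k)\<close> at height \<epsilon> 2^k / l
  is first exchanged for that of the level sets; only then is the sum over k estimated pointwise by
  \<open>level_sum_le\<close>.\<close>

lemma time_sum_bound:
  assumes l: "0 < l" "(\<integral>\<^sup>+ x. phiE \<phi> x (fnorm q f x / ennreal l) \<partial>M) \<le> 1" and \<epsilon>: "0 < \<epsilon>" "\<epsilon> < 1"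
    and small: "R * K * C / (1 - 2 powr (- p)) * \<epsilon> powr p \<le> 1"
  shows "(\<integral>\<^sup>+x. (\<Sum>\<^sub>\<infinity>k\<in>UNIV. ennreal (\<phi> x (\<epsilon> * 2 powr (of_int k) / l)) * indicator (Bset M (time f k)) x) \<partial>M) \<le> 1"
proof -
  have pos: "0 \<le> \<epsilon> * 2 powr (of_int k) / l" for k using \<epsilon> l by simp
  have [measurable]: "(\<lambda>x. \<phi> x (\<epsilon> * 2 powr (of_int k) / l)) \<in> borel_measurable M" for k
    by (rule phi_measurable[OF pos])
  have [measurable]: "Bset M (time f k) \<in> sets M" for k by (rule Bset_time_measurable)
  have [measurable]: "level f k n \<in> sets M" for k n by (rule sets_F_M[OF level_sets])
  have "(\<integral>\<^sup>+x. (\<Sum>\<^sub>\<infinity>k\<in>UNIV. ennreal (\<phi> x (\<epsilon> * 2 powr (of_int k) / l)) * indicator (Bset M (time f k)) x) \<partial>M)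
     = (\<Sum>\<^sub>\<infinity>k\<in>UNIV. \<integral>\<^sup>+x. ennreal (\<phi> x (\<epsilon> * 2 powr (of_int k) / l)) * indicator (Bset M (time f k)) x \<partial>M)"
    by (rule nn_integral_infsum_int) measurable
  also have "\<dots> \<le> (\<Sum>\<^sub>\<infinity>k\<in>UNIV. ennreal (R * K) *
      (\<integral>\<^sup>+x. ennreal (\<phi> x (\<epsilon> * 2 powr (of_int k) / l)) * indicator (\<Union>n. level f k n) x \<partial>M))"
    by (intro infsum_mono_ennreal time_weight_bound pos)
  also have "\<dots> = ennreal (R * K) *
      (\<integral>\<^sup>+x. (\<Sum>\<^sub>\<infinity>k\<in>UNIV. ennreal (\<phi> x (\<epsilon> * 2 powr (of_int k) / l)) * indicator (\<Union>n. level f k n) x) \<partial>M)"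
    unfolding infsum_int_cmult_ennreal by (subst nn_integral_infsum_int) auto
  also have "\<dots> = (\<integral>\<^sup>+x. ennreal (R * K) *
      (\<Sum>\<^sub>\<infinity>k\<in>UNIV. ennreal (\<phi> x (\<epsilon> * 2 powr (of_int k) / l)) * indicator (\<Union>n. level f k n) x) \<partial>M)"
    unfolding infsum_int_ennreal by (rule nn_integral_cmult[symmetric]) measurable
  \<comment> \<open>Monotonicity of the integral suffices here, as the right-hand integrand may fail
    to be measurable.\<close>
  also have "\<dots> \<le> (\<integral>\<^sup>+ x. phiE \<phi> x (fnorm q f x / ennreal l) \<partial>M)"
    by (intro nn_integral_mono level_sum_le l \<epsilon> small)
  finally show ?thesis using l(2) by simp
qed

text \<open>The sum in \<open>time_sum_bound\<close> is finite almost everywhere, while at a point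
  of all these sets every term with k \<ge> 0 would be at least \<phi>(x, \<epsilon> / l) > 0. This
  provides the upper end of the telescope.\<close>

lemma leaves_Bset_AE:
  assumes l: "0 < l" "(\<integral>\<^sup>+ x. phiE \<phi> x (fnorm q f x / ennreal l) \<partial>M) \<le> 1" and \<epsilon>: "0 < \<epsilon>" "\<epsilon> < 1"
    and small: "R * K * C / (1 - 2 powr (- p)) * \<epsilon> powr p \<le> 1"
  shows "AE x in M. \<exists>k. x \<notin> Bset M (time f k)"
proof -
  have pos: "0 \<le> \<epsilon> * 2 powr (of_int k) / l" for k using \<epsilon> l by simp
  let ?S = "\<lambda>x. \<Sum>\<^sub>\<infinity>k\<in>UNIV. ennreal (\<phi> x (\<epsilon> * 2 powr (of_int k) / l)) * indicator (Bset M (time f k)) x"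
  have [measurable]: "(\<lambda>x. \<phi> x (\<epsilon> * 2 powr (of_int k) / l)) \<in> borel_measurable M" for k
    by (rule phi_measurable[OF pos])
  have [measurable]: "Bset M (time f k) \<in> sets M" for k by (rule Bset_time_measurable)
  have "?S \<in> borel_measurable M" unfolding infsum_int_ennreal by measurable
  moreover have "(\<integral>\<^sup>+x. ?S x \<partial>M) \<noteq> \<infinity>"
    using time_sum_bound[OF l \<epsilon> small] by (auto simp: top_unique)
  ultimately have "AE x in M. ?S x \<noteq> \<infinity>" by (rule nn_integral_PInf_AE)
  then show ?thesis using AE_space
  proof eventually_elim
    case (elim x)
    show ?case
    proof (rule ccontr)
      assume "\<not> ?thesis"
      then have x: "x \<in> Bset M (time f k)" for k by blast
      define d where "d = \<phi> x (\<epsilon> / l)"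
      have d: "0 < d" unfolding d_def using \<epsilon> l elim by (intro phi_pos) auto
      obtain b where b: "?S x = ennreal b" "0 \<le> b"
        using elim(1) by (cases "?S x" rule: ennreal_cases) auto
      obtain n where n: "b / d < real n" using reals_Archimedean2 by blast
      have d_le: "ennreal d \<le> ennreal (\<phi> x (\<epsilon> * 2 powr (of_int k) / l))" if "0 \<le> k" for k :: int
      proof -
        have "1 \<le> (2::real) powr (of_int k)" using that by (intro ge_one_powr_ge_zero) auto
        then have "\<epsilon> * 1 / l \<le> \<epsilon> * 2 powr (of_int k) / l"
          using \<epsilon> l by (intro divide_right_mono mult_left_mono) auto
        then show ?thesis unfolding d_def using \<epsilon> l elim by (intro ennreal_leI phi_mono) auto
      qed
      have "(\<Sum>k\<in>int ` {..<n}. ennreal d)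
          \<le> (\<Sum>k\<in>int ` {..<n}. ennreal (\<phi> x (\<epsilon> * 2 powr (of_int k) / l)) * indicator (Bset M (time f k)) x)"
      proof (rule sum_mono)
        fix k assume "k \<in> int ` {..<n}"
        then have "0 \<le> k" by auto
        from d_le[OF this] show "ennreal d
            \<le> ennreal (\<phi> x (\<epsilon> * 2 powr (of_int k) / l)) * indicator (Bset M (time f k)) x"
          using x by simp
      qed
      also have "\<dots> \<le> ?S x" by (intro sum_le_infsum_ennreal) auto
      finally have "ennreal (real n * d) \<le> ennreal b"
        using d by (simp add: b card_image ennreal_mult ennreal_of_nat_eq_real_of_nat)
      then have "real n * d \<le> b" using b by simp
      then show False using n d by (simp add: field_simps)
    qed
  qed
qed

section \<open>Slices between consecutive stopping times, and the atoms built from them\<close>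

definition slice :: "int \<Rightarrow> nat \<Rightarrow> 'a \<Rightarrow> real" where
  "slice k n x = stopped f (time f (k + 1)) n x - stopped f (time f k) n x"

lemma slice_martingale: "martingale M F (slice k)"
  unfolding slice_def by (intro martingale_diff martingale_stopped f stopping_time)

text \<open>Up to the earlier of two nested times both stopped values equal those of
  \<open>f\<close>, so the slice vanishes there; the constant 3 is 2 + 1, from 2^(k + 1) +
  2^k.\<close>

lemma slice_AE:
  "AE x in M. \<forall>k. slice k 0 x = 0 \<and> (\<forall>n. enat n \<le> time f k x \<longrightarrow> slice k n x = 0) \<and>
     (\<forall>n. q n (\<lambda>i. stopped f (time f k) i x) \<le> 2 powr (of_int k)) \<and>
     (\<forall>n. q n (\<lambda>i. slice k i x) \<le> 3 * 2 powr (of_int k))"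
  using time_Suc_AE q_before_time_AE
proof eventually_elim
  case (elim x)
  have time_mono: "enat n \<le> time f (k + 1) x" if "enat n \<le> time f k x" for k n
    using that elim(1) by (auto simp: time_def le_entry_iff)
  have qs: "q n (\<lambda>i. stopped f (time f k) i x) \<le> 2 powr (of_int k)" for k n
    using elim(2) by (intro q_stopped_le) auto
  have van: "slice k n x = 0" if "enat n \<le> time f k x" for k n
    using that time_mono[OF that] by (simp add: slice_def stopped_eq)
  have "q n (\<lambda>i. slice k i x) \<le> 3 * 2 powr (of_int k)" for k n
  proof -
    have "q n (\<lambda>i. slice k i x) \<le> q n (\<lambda>i. stopped f (time f (k + 1)) i x) + q n (\<lambda>i. stopped f (time f k) i x)"
      unfolding slice_def by (rule q_diff)
    also have "\<dots> \<le> 2 powr (of_int (k + 1)) + 2 powr (of_int k)" by (intro add_mono qs)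
    also have "\<dots> = 3 * 2 powr (of_int k)" by (simp add: powr_add)
    finally show ?thesis .
  qed
  then show ?case using qs van van[of 0] by (simp add: zero_enat_def[symmetric])
qed

text \<open>The telescope ends above because \<open>time f k x\<close> is infinite for large k,
  where the stopped value is \<open>f n x\<close>, and below because the stopped values at a fixed n
  are O(2^k).\<close>

lemma slice_sum_AE:
  assumes "AE x in M. \<exists>k. x \<notin> Bset M (time f k)"
  shows "AE x in M. \<forall>n. ((\<lambda>k. slice k n x) has_sum f n x) UNIV"
  using assms slice_AE time_Suc_AE f0 AE_space
proof eventually_elim
  case (elim x)
  obtain k0 where k0: "x \<notin> Bset M (time f k0)" using elim(1) by blast
  have inf: "time f (k0 + int j) x = \<infinity>" for j
  proof -
    have "x \<notin> Bset M (time f (k0 + int j))"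
    proof (induction j)
      case (Suc j)
      have "x \<in> Bset M (time f (k + 1)) \<Longrightarrow> x \<in> Bset M (time f k)" for k
        using elim(3) by (auto simp: Bset_time)
      from this[of "k0 + int j"] Suc show ?case by (auto simp: algebra_simps)
    qed (use k0 in simp)
    then show ?thesis using elim(5) by (simp add: Bset_def)
  qed
  have inf': "time f k x = \<infinity>" if "k0 \<le> k" for k
    using inf[of "nat (k - k0)"] that by simp
  show ?case
  proof
    fix n
    have "((\<lambda>k. stopped f (time f (k + 1)) n x - stopped f (time f k) n x) has_sum f n x) UNIV"
    proof (rule has_sum_telescope_int)
      show "stopped f (time f k) n x = f n x" if "k0 \<le> k" for k
        using inf'[OF that] by (simp add: stopped_eq)
      fix k
      have "stopped f (time f k) 0 x = 0"
        using elim(4) stopped_eq[of 0 "time f k" x f] by (simp add: zero_enat_def[symmetric])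
      then have "\<bar>stopped f (time f k) n x\<bar> \<le> 2 * real n * q n (\<lambda>i. stopped f (time f k) i x)"
        by (rule abs_le_q)
      also have "\<dots> \<le> 2 * real n * 2 powr (of_int k)" using elim(2) by (intro mult_left_mono) auto
      finally show "\<bar>stopped f (time f k) n x\<bar> \<le> 2 * real n * 2 powr (of_int k)" .
    qed
    then show "((\<lambda>k. slice k n x) has_sum f n x) UNIV" by (simp add: slice_def)
  qed
qed

lemma slice_closed:
  obtains \<alpha> where "integrable M \<alpha>" "\<And>n. AE x in M. condE M F n \<alpha> x = slice k n x"
proof (rule q_bounded_martingale_closed[OF slice_martingale])
  show "AE x in M. slice k 0 x = 0" using slice_AE by eventually_elim blast
  show "AE x in M. \<forall>n. q n (\<lambda>i. slice k i x) \<le> 3 * 2 powr (of_int k)"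
    using slice_AE by eventually_elim blast
qed (rule that)

text \<open>Passing to a real number loses nothing, by \<open>lux_indicator_finite\<close>.\<close>

definition wt :: "int \<Rightarrow> real" where
  "wt k = enn2real (lux M \<phi> (indicator (Bset M (time f k))))"

text \<open>Division by this number turns the bound 3 2^k of the slice into the bound 1 /
  \<open>wt k\<close> required of an atom.\<close>

definition coef :: "int \<Rightarrow> real" where
  "coef k = 3 * 2 powr (of_int k) * wt k"

lemma wt: "lux M \<phi> (indicator (Bset M (time f k))) = ennreal (wt k)" "0 \<le> wt k"
  unfolding wt_def using lux_indicator_finite[of "Bset M (time f k)"] by (auto simp: less_top)

text \<open>The degenerate case \<open>coef k = 0\<close>, in which the slice cannot be recovered
  from a quotient: \<open>Bset M (time f k)\<close> is then a null set, and the slice vanishes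
  outside it.\<close>

lemma slice_wt_0:
  assumes "wt k = 0"
  shows "AE x in M. \<forall>n. slice k n x = 0"
proof -
  have "AE x in M. x \<notin> Bset M (time f k)"
    using wt[of k] assms by (intro lux_indicator_eq_0 Bset_time_measurable) simp
  then show ?thesis using slice_AE AE_space
  proof eventually_elim
    case (elim x)
    then have "time f k x = \<infinity>" by (simp add: Bset_def)
    then show ?case using elim(2) by simp
  qed
qed

lemma atdec_slices:
  assumes "AE x in M. \<exists>k. x \<notin> Bset M (time f k)"
  shows "\<exists>a. atdec M F \<phi> (fnorm q) f coef a (time f)"
proof -
  obtain \<alpha> where \<alpha>: "\<And>k. integrable M (\<alpha> k)" "\<And>k n. AE x in M. condE M F n (\<alpha> k) x = slice k n x"
  proof -
    have "\<forall>k. \<exists>\<alpha>. integrable M \<alpha> \<and> (\<forall>n. AE x in M. condE M F n \<alpha> x = slice k n x)"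
    proof
      fix k
      show "\<exists>\<alpha>. integrable M \<alpha> \<and> (\<forall>n. AE x in M. condE M F n \<alpha> x = slice k n x)"
        by (rule slice_closed[of k]) blast
    qed
    from choice[OF this] obtain \<alpha>
      where "\<forall>k. integrable M (\<alpha> k) \<and> (\<forall>n. AE x in M. condE M F n (\<alpha> k) x = slice k n x)" ..
    then show thesis by (intro that[of \<alpha>]) blast+
  qed
  \<comment> \<open>For \<open>coef k = 0\<close> the quotient is the zero function, in accordance
    with \<open>slice_wt_0\<close>.\<close>
  define a where "a k x = \<alpha> k x / coef k" for k x
  have coef0: "0 \<le> coef k" for k using wt(2)[of k] by (simp add: coef_def)
  have a_int: "integrable M (a k)" for k unfolding a_def using \<alpha>(1) by auto
  have a_cond: "AE x in M. \<forall>n. condE M F n (a k) x = slice k n x / coef k" for k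
    unfolding AE_all_countable
  proof
    fix n
    have "AE x in M. condE M F n (a k) x = condE M F n (\<alpha> k) x / coef k"
      unfolding a_def by (rule CE.real_cond_exp_cdiv[OF \<alpha>(1)])
    then show "AE x in M. condE M F n (a k) x = slice k n x / coef k"
      using \<alpha>(2)[of n k] by eventually_elim simp
  qed
  have "atom M F \<phi> (fnorm q) (a k) (time f k)" for k
    unfolding atom_def
  proof (intro conjI allI a_int stopping_time)
    show "AE x in M. enat n \<le> time f k x \<longrightarrow> condE M F n (a k) x = 0" for n
      using a_cond[of k] slice_AE by eventually_elim simp
    show "AE x in M. x \<in> Bset M (time f k) \<longrightarrow> fnorm q (\<lambda>n. condE M F n (a k)) x
       \<le> inverse (lux M \<phi> (indicator (Bset M (time f k))))"
      using a_cond[of k] slice_AE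
    proof eventually_elim
      case (elim x)
      \<comment> \<open>If \<open>wt k = 0\<close>, the right-hand side is the inverse of 0 in the
        extended reals, which is infinite.\<close>
      have "fnorm q (\<lambda>n. condE M F n (a k)) x \<le> inverse (ennreal (wt k))"
      proof (cases "wt k = 0")
        case False
        then have w: "0 < wt k" using wt(2)[of k] by simp
        have "ennreal (q n (\<lambda>i. condE M F i (a k) x)) \<le> ennreal (1 / wt k)" for n
        proof (rule ennreal_leI)
          have "q n (\<lambda>i. condE M F i (a k) x) = q n (\<lambda>i. (1 / coef k) * slice k i x)"
            using elim(1) by simp
          also have "\<dots> = \<bar>1 / coef k\<bar> * q n (\<lambda>i. slice k i x)" by (rule scale)
          also have "\<dots> \<le> \<bar>1 / coef k\<bar> * (3 * 2 powr (of_int k))"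
            using elim(2) by (intro mult_left_mono) auto
          also have "\<dots> = 1 / wt k" using w by (simp add: coef_def)
          finally show "q n (\<lambda>i. condE M F i (a k) x) \<le> 1 / wt k" .
        qed
        then have "fnorm q (\<lambda>n. condE M F n (a k)) x \<le> ennreal (1 / wt k)"
          unfolding fnorm_def by (rule SUP_least)
        then show ?thesis using w by (simp add: inverse_ennreal inverse_eq_divide)
      qed simp
      then show ?case by (simp add: wt)
    qed
  qed
  moreover have "AE x in M. ((\<lambda>k. coef k * condE M F n (a k) x) has_sum f n x) UNIV" for n
  proof -
    have "AE x in M. \<forall>k. coef k * condE M F n (a k) x = slice k n x"
      unfolding AE_all_countable
    proof
      fix k
      show "AE x in M. coef k * condE M F n (a k) x = slice k n x"
      proof (cases "wt k = 0")
        case True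
        show ?thesis using a_cond[of k] slice_wt_0[OF True]
          by eventually_elim (simp add: coef_def True)
      next
        case False
        then have nz: "coef k \<noteq> 0" by (simp add: coef_def)
        show ?thesis using a_cond[of k] by eventually_elim (simp add: nz)
      qed
    qed
    then show ?thesis using slice_sum_AE[OF assms] by eventually_elim simp
  qed
  ultimately have "atdec M F \<phi> (fnorm q) f coef a (time f)"
    using coef0 by (auto simp: atdec_def)
  then show ?thesis by blast
qed

text \<open>At a point let m be the last index with x in \<open>Bset M (time f m)\<close>. The r-sum
  is geometric and its root is at most c 2^m, so the scaled integrand is at most \<phi>(x,
  \<epsilon> 2^m / l), a single term of the sum in \<open>time_sum_bound\<close>. The 3 in
  \<open>c\<close> comes from \<open>coef\<close>, the rest from the geometric series.\<close>

lemma atq_slices_le: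
  assumes l: "0 < l" "(\<integral>\<^sup>+ x. phiE \<phi> x (fnorm q f x / ennreal l) \<partial>M) \<le> 1" and \<epsilon>: "0 < \<epsilon>" "\<epsilon> < 1"
    and small: "R * K * C / (1 - 2 powr (- p)) * \<epsilon> powr p \<le> 1"
    and r: "0 < r" and c: "c = 3 * (1 / (1 - 2 powr (- r))) powr (1 / r)"
  shows "atq M \<phi> r coef (time f) \<le> ennreal (c / \<epsilon> * l)"
proof -
  define Z where "Z = 1 / (1 - (2::real) powr (- r))"
  have Z: "0 < Z" using r by (simp add: Z_def powr_less_one)
  have c0: "0 < c" using Z by (simp add: c Z_def[symmetric])
  let ?L = "c / \<epsilon> * l"
  have L: "0 < ?L" using c0 \<epsilon> l by simp
  let ?B = "\<lambda>k. Bset M (time f k)"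
  let ?H = "\<lambda>x. epow (\<Sum>\<^sub>\<infinity>k\<in>UNIV. epow (ennreal (coef k) * indicator (?B k) x / lux M \<phi> (indicator (?B k))) r) (1 / r)"
  have "(\<integral>\<^sup>+ x. phiE \<phi> x (?H x / ennreal ?L) \<partial>M)
     \<le> (\<integral>\<^sup>+x. (\<Sum>\<^sub>\<infinity>k\<in>UNIV. ennreal (\<phi> x (\<epsilon> * 2 powr (of_int k) / l)) * indicator (?B k) x) \<partial>M)"
  proof (rule nn_integral_mono_AE)
    show "AE x in M. phiE \<phi> x (?H x / ennreal ?L)
       \<le> (\<Sum>\<^sub>\<infinity>k\<in>UNIV. ennreal (\<phi> x (\<epsilon> * 2 powr (of_int k) / l)) * indicator (?B k) x)"
      using leaves_Bset_AE[OF l \<epsilon> small] time_Suc_AE AE_space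
    proof eventually_elim
      case (elim x)
      \<comment> \<open>The quasi-norm inside \<open>coef\<close> cancels; for
        \<open>wt k = 0\<close> the left-hand side is 0.\<close>
      have term_le: "ennreal (coef k) * indicator (?B k) x / lux M \<phi> (indicator (?B k))
          \<le> ennreal (3 * 2 powr (of_int k)) * indicator (?B k) x" for k
      proof (cases "wt k = 0")
        case False
        then have "0 < wt k" using wt(2)[of k] by simp
        then show ?thesis
          by (auto simp: wt coef_def divide_ennreal split: split_indicator)
      qed (simp add: coef_def)
      show ?case
      proof (cases "\<exists>k. x \<in> ?B k")
        case False
        have "?H x = 0" using False r by (simp add: epow_def)
        then have "phiE \<phi> x (?H x / ennreal ?L) = 0" using elim by (simp add: phiE_def phi_0)
        then show ?thesis by simp
      next
        case True
        then obtain k where "x \<in> ?B k" by blast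
        moreover obtain k' where "x \<notin> ?B k'" using elim(1) by blast
        moreover have "x \<in> ?B k" if "x \<in> ?B (k + 1)" for k
          using that elim(2) by (auto simp: Bset_time)
        ultimately obtain m where m: "x \<in> ?B m" "\<And>k. x \<in> ?B k \<Longrightarrow> k \<le> m"
          using dyadic_last_index[of "{k. x \<in> ?B k}" k k'] by auto
        define t where "t = (2::real) powr (of_int m)"
        have t: "0 < t" by (simp add: t_def)
        \<comment> \<open>Factoring out (3 t)^r leaves the terms of
          \<open>dyadic_geometric_bound\<close> with exponent r.\<close>
        have "epow (ennreal (coef k) * indicator (?B k) x / lux M \<phi> (indicator (?B k))) r
          \<le> ennreal ((3 * t) powr r) *
             (if 2 powr (of_int k) \<le> t then ennreal ((2 powr (of_int k) / t) powr r) else 0)" for k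
        proof (cases "x \<in> ?B k")
          case True
          have kt: "2 powr (of_int k) \<le> t" unfolding t_def using m(2)[OF True] by simp
          have "epow (ennreal (coef k) * indicator (?B k) x / lux M \<phi> (indicator (?B k))) r
              \<le> epow (ennreal (3 * 2 powr (of_int k))) r"
            using term_le[of k] True by (intro epow_mono r) simp
          also have "\<dots> = ennreal (((3 * t) * (2 powr (of_int k) / t)) powr r)"
            using t by (simp add: epow_def)
          also have "((3 * t) * (2 powr (of_int k) / t)) powr r = (3 * t) powr r * (2 powr (of_int k) / t) powr r"
            using t by (intro powr_mult)
          finally show ?thesis using kt by (simp add: ennreal_mult)
        qed (use r in \<open>simp add: epow_def\<close>)
        then have "(\<Sum>\<^sub>\<infinity>k\<in>UNIV. epow (ennreal (coef k) * indicator (?B k) x / lux M \<phi> (indicator (?B k))) r)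
          \<le> ennreal ((3 * t) powr r) *
             (\<Sum>\<^sub>\<infinity>k\<in>UNIV. if 2 powr (of_int k) \<le> t then ennreal ((2 powr (of_int k) / t) powr r) else 0)"
          unfolding infsum_int_cmult_ennreal[symmetric] by (intro infsum_mono_ennreal)
        also have "\<dots> \<le> ennreal ((3 * t) powr r) * ennreal Z"
          unfolding Z_def by (intro mult_left_mono dyadic_geometric_bound r t) simp
        also have "\<dots> = ennreal ((3 * t) powr r * Z)" using Z by (simp add: ennreal_mult)
        finally have "?H x \<le> epow (ennreal ((3 * t) powr r * Z)) (1 / r)"
          using r by (intro epow_mono) auto
        also have "\<dots> = ennreal (((3 * t) powr r * Z) powr (1 / r))"
          using Z by (simp add: epow_def)
        also have "((3 * t) powr r * Z) powr (1 / r) = ((3 * t) powr r) powr (1 / r) * Z powr (1 / r)"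
          using Z by (intro powr_mult)
        also have "\<dots> = c * t" using r t by (simp add: powr_powr c Z_def)
        finally have "?H x / ennreal ?L \<le> ennreal (c * t) / ennreal ?L" by (rule divide_right_mono_ennreal)
        also have "\<dots> = ennreal (c * t / ?L)" using c0 t L by (intro divide_ennreal) auto
        also have "c * t / ?L = \<epsilon> * t / l" using c0 \<epsilon> l by simp
        finally have "phiE \<phi> x (?H x / ennreal ?L) \<le> phiE \<phi> x (ennreal (\<epsilon> * t / l))"
          using elim by (intro phiE_mono[OF MO])
        also have "\<dots> = ennreal (\<phi> x (\<epsilon> * 2 powr (of_int m) / l)) * indicator (?B m) x"
          using m(1) \<epsilon> l t by (simp add: phiE_def t_def)
        also have "\<dots> \<le> (\<Sum>\<^sub>\<infinity>k\<in>UNIV. ennreal (\<phi> x (\<epsilon> * 2 powr (of_int k) / l)) * indicator (?B k) x)"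
          by (rule infsum_ge_ennreal[where u = "\<lambda>k. ennreal (\<phi> x (\<epsilon> * 2 powr (of_int k) / l)) * indicator (?B k) x"]) simp
        finally show ?thesis .
      qed
    qed
  qed
  also have "\<dots> \<le> 1" by (rule time_sum_bound[OF l \<epsilon> small])
  finally show ?thesis unfolding atq_def using L by (intro lux_le)
qed

end

section \<open>Equivalence of the quasi-norms\<close>

lemma small_parameter:
  obtains \<epsilon> where "0 < \<epsilon>" "\<epsilon> < 1" "R * K * C / (1 - 2 powr (- p)) * \<epsilon> powr p \<le> 1"
proof -
  define A where "A = R * K * C / (1 - 2 powr (- p))"
  have A: "0 < A" using R K C p by (simp add: A_def powr_less_one)
  \<comment> \<open>Solves \<epsilon>^p = 1 / (A + 2), whence A \<epsilon>^p < 1; the base exceeds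
    1, so \<epsilon> < 1.\<close>
  define \<epsilon> where "\<epsilon> = (A + 2) powr (- 1 / p)"
  have "0 < \<epsilon>" using A by (simp add: \<epsilon>_def)
  moreover have "\<epsilon> < 1"
  proof -
    have "\<epsilon> < (A + 2) powr 0" unfolding \<epsilon>_def using A p by (intro powr_less_mono) auto
    then show ?thesis using A by simp
  qed
  moreover have "A * \<epsilon> powr p \<le> 1"
  proof -
    have "\<epsilon> powr p = 1 / (A + 2)" unfolding \<epsilon>_def powr_powr using A p by (simp add: powr_minus_divide)
    then show ?thesis using A by (simp add: divide_le_eq)
  qed
  ultimately show thesis unfolding A_def by (rule that)
qed

text \<open>The constant, c / \<epsilon> in the proof, is chosen before \<open>f\<close> and
  \<open>l\<close>; this uniformity yields a quasi-norm inequality once the infimum over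
  \<open>l\<close> is taken.\<close>

lemma atomic_decomposition:
  assumes r: "0 < r"
  obtains L where "0 < L"
    "\<And>f l. \<lbrakk>f \<in> mart0 M F; 0 < l; (\<integral>\<^sup>+ x. phiE \<phi> x (fnorm q f x / ennreal l) \<partial>M) \<le> 1\<rbrakk> \<Longrightarrow>
      \<exists>\<mu> a \<nu>. atdec M F \<phi> (fnorm q) f \<mu> a \<nu> \<and> atq M \<phi> r \<mu> \<nu> \<le> ennreal (L * l)"
proof -
  obtain \<epsilon> where \<epsilon>: "0 < \<epsilon>" "\<epsilon> < 1" "R * K * C / (1 - 2 powr (- p)) * \<epsilon> powr p \<le> 1"
    by (rule small_parameter)
  define c where "c = 3 * (1 / (1 - (2::real) powr (- r))) powr (1 / r)"
  have "0 < c" unfolding c_def using r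
    by (simp add: powr_less_one)
  show thesis
  proof (rule that)
    show "0 < c / \<epsilon>" using \<open>0 < c\<close> \<epsilon> by simp
    fix f l
    assume f: "f \<in> mart0 M F" and l: "0 < l" "(\<integral>\<^sup>+ x. phiE \<phi> x (fnorm q f x / ennreal l) \<partial>M) \<le> 1"
    have mf: "martingale M F f" "AE x in M. f 0 x = 0" using f by (auto simp: mart0_def)
    obtain a where "atdec M F \<phi> (fnorm q) f (coef f) a (time f)"
      using atdec_slices[OF mf leaves_Bset_AE[OF mf l \<epsilon>]] by blast
    moreover have "atq M \<phi> r (coef f) (time f) \<le> ennreal (c / \<epsilon> * l)"
      by (rule atq_slices_le[OF mf l \<epsilon> r c_def])
    ultimately show "\<exists>\<mu> a \<nu>. atdec M F \<phi> (fnorm q) f \<mu> a \<nu> \<and> atq M \<phi> r \<mu> \<nu> \<le> ennreal (c / \<epsilon> * l)"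
      by blast
  qed
qed

theorem Hsp_eq_Hat:
  assumes r: "0 < r" "r \<le> 1"
  shows "Hsp M F \<phi> (fnorm q) = Hat M F \<phi> (fnorm q) r"
    and "\<exists>L>0. \<forall>f\<in>Hsp M F \<phi> (fnorm q).
      atnorm M F \<phi> (fnorm q) r f \<le> ennreal L * lux M \<phi> (fnorm q f) \<and>
      lux M \<phi> (fnorm q f) \<le> ennreal L * atnorm M F \<phi> (fnorm q) r f"
proof -
  obtain L where L: "0 < L" and dec: "\<And>f l. \<lbrakk>f \<in> mart0 M F; 0 < l; (\<integral>\<^sup>+ x. phiE \<phi> x (fnorm q f x / ennreal l) \<partial>M) \<le> 1\<rbrakk> \<Longrightarrow>
      \<exists>\<mu> a \<nu>. atdec M F \<phi> (fnorm q) f \<mu> a \<nu> \<and> atq M \<phi> r \<mu> \<nu> \<le> ennreal (L * l)"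
    using atomic_decomposition[OF r(1)] by metis
  show "Hsp M F \<phi> (fnorm q) = Hat M F \<phi> (fnorm q) r"
  proof (intro set_eqI iffI)
    fix f assume f: "f \<in> Hsp M F \<phi> (fnorm q)"
    then obtain l where "0 < l" "(\<integral>\<^sup>+ x. phiE \<phi> x (fnorm q f x / ennreal l) \<partial>M) \<le> 1"
      unfolding Hsp_def lux_def mem_Collect_eq Inf_less_iff by blast
    then obtain \<mu> a \<nu> where "atdec M F \<phi> (fnorm q) f \<mu> a \<nu>" "atq M \<phi> r \<mu> \<nu> \<le> ennreal (L * l)"
      using dec f unfolding Hsp_def by blast
    then show "f \<in> Hat M F \<phi> (fnorm q) r"
      using f le_less_trans[OF _ ennreal_less_top] unfolding Hsp_def Hat_def by blast
  next
    fix f assume "f \<in> Hat M F \<phi> (fnorm q) r"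
    then show "f \<in> Hsp M F \<phi> (fnorm q)"
      using lux_le_atq[OF MO _ r] le_less_trans unfolding Hsp_def Hat_def by blast
  qed
  \<comment> \<open>The converse estimate holds with constant 1, so this number serves for
    both.\<close>
  define L' where "L' = max L 1"
  have "atnorm M F \<phi> (fnorm q) r f \<le> ennreal L' * lux M \<phi> (fnorm q f) \<and>
      lux M \<phi> (fnorm q f) \<le> ennreal L' * atnorm M F \<phi> (fnorm q) r f" if f: "f \<in> Hsp M F \<phi> (fnorm q)" for f
  proof
    \<comment> \<open>Dividing by \<open>L\<close> leaves a lower bound for every admissible
      \<open>l\<close>, hence for their infimum.\<close>
    have "atnorm M F \<phi> (fnorm q) r f / ennreal L \<le> lux M \<phi> (fnorm q f)"
      unfolding lux_def
    proof (rule Inf_greatest, safe)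
      fix l :: real assume l: "0 < l" "(\<integral>\<^sup>+ x. phiE \<phi> x (fnorm q f x / ennreal l) \<partial>M) \<le> 1"
      then obtain \<mu> a \<nu> where d: "atdec M F \<phi> (fnorm q) f \<mu> a \<nu>" "atq M \<phi> r \<mu> \<nu> \<le> ennreal (L * l)"
        using dec f unfolding Hsp_def by blast
      have "atnorm M F \<phi> (fnorm q) r f \<le> atq M \<phi> r \<mu> \<nu>"
        unfolding atnorm_def using d(1) by (intro Inf_lower) blast
      then have "atnorm M F \<phi> (fnorm q) r f \<le> ennreal (L * l)" using d(2) by (rule order_trans)
      then have "atnorm M F \<phi> (fnorm q) r f / ennreal L \<le> ennreal (L * l) / ennreal L"
        by (rule divide_right_mono_ennreal)
      also have "\<dots> = ennreal l" using L l by (simp add: divide_ennreal)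
      finally show "atnorm M F \<phi> (fnorm q) r f / ennreal L \<le> ennreal l" .
    qed
    then have "ennreal L * (atnorm M F \<phi> (fnorm q) r f / ennreal L) \<le> ennreal L * lux M \<phi> (fnorm q f)"
      by (rule mult_left_mono) simp
    also have "ennreal L * (atnorm M F \<phi> (fnorm q) r f / ennreal L) = atnorm M F \<phi> (fnorm q) r f"
      using L by (simp add: ennreal_times_divide mult.commute[of "ennreal L"] ennreal_mult_divide_eq)
    also have "ennreal L * lux M \<phi> (fnorm q f) \<le> ennreal L' * lux M \<phi> (fnorm q f)"
      by (intro mult_right_mono ennreal_leI) (auto simp: L'_def)
    finally show "atnorm M F \<phi> (fnorm q) r f \<le> ennreal L' * lux M \<phi> (fnorm q f)" .
    have "lux M \<phi> (fnorm q f) \<le> 1 * atnorm M F \<phi> (fnorm q) r f"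
      unfolding atnorm_def mult_1 by (rule Inf_greatest) (use lux_le_atq[OF MO _ r] in blast)
    also have "\<dots> \<le> ennreal L' * atnorm M F \<phi> (fnorm q) r f"
      by (intro mult_right_mono) (auto simp: L'_def ennreal_1[symmetric] simp del: ennreal_1 intro: ennreal_leI)
    finally show "lux M \<phi> (fnorm q f) \<le> ennreal L' * atnorm M F \<phi> (fnorm q) r f" .
  qed
  then show "\<exists>L>0. \<forall>f\<in>Hsp M F \<phi> (fnorm q).
      atnorm M F \<phi> (fnorm q) r f \<le> ennreal L * lux M \<phi> (fnorm q f) \<and>
      lux M \<phi> (fnorm q f) \<le> ennreal L * atnorm M F \<phi> (fnorm q) r f"
    by (intro exI[of _ L']) (auto simp: L'_def)
qed

end

theorem theorem4p6:
  fixes M :: "'a measure" and F :: "nat \<Rightarrow> 'a measure" and \<phi> :: "'a \<Rightarrow> real \<Rightarrow> real"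
    and p r :: real
  assumes "prob_space M" and "filtr M F"
    and "MO_function M \<phi>" and "0 < p" and "unif_lower_type M \<phi> p"
    and "S_minus M F \<phi>" and "regular M F"
    and "0 < r" and "r \<le> 1"
  shows "Hsp M F \<phi> maxf = Hat M F \<phi> maxf r \<and>
         (\<exists>C>0. \<forall>f\<in>Hsp M F \<phi> maxf.
            atnorm M F \<phi> maxf r f \<le> ennreal C * lux M \<phi> (maxf f) \<and>
            lux M \<phi> (maxf f) \<le> ennreal C * atnorm M F \<phi> maxf r f) \<and>
         Hsp M F \<phi> sqf = Hat M F \<phi> sqf r \<and>
         (\<exists>C>0. \<forall>f\<in>Hsp M F \<phi> sqf.
            atnorm M F \<phi> sqf r f \<le> ennreal C * lux M \<phi> (sqf f) \<and>
            lux M \<phi> (sqf f) \<le> ennreal C * atnorm M F \<phi> sqf r f)"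
proof -
  interpret filtered_prob M F
    using assms(1,2) by (intro filtered_prob.intro filtered_prob_axioms.intro)
  obtain R where R: "R > 0" "\<And>n D. D \<in> sets (F (Suc n)) \<Longrightarrow> AE x in M. x \<in> D \<longrightarrow> x \<in> cover R n D"
    using regular_cover[OF assms(7)] by metis
  obtain K where K: "K > 0" "\<And>t n. t \<ge> 0 \<Longrightarrow> n \<ge> 1 \<Longrightarrow>
      AE x in M. inverse K * condE M F (n - 1) (\<lambda>y. \<phi> y t) x \<le> condE M F n (\<lambda>y. \<phi> y t) x"
    using assms(6) unfolding S_minus_def by blast
  have S: "AE x in M. condE M F n (\<lambda>y. \<phi> y t) x \<le> K * condE M F (Suc n) (\<lambda>y. \<phi> y t) x" if "0 \<le> t" for t n
    using K(2)[OF that, of "Suc n"] K(1) by (simp add: field_simps)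
  obtain C0 where C0: "\<And>x t s. x \<in> space M \<Longrightarrow> 0 \<le> t \<Longrightarrow> 0 < s \<Longrightarrow> s < 1 \<Longrightarrow> \<phi> x (s * t) \<le> C0 * s powr p * \<phi> x t"
    using assms(5) unfolding unif_lower_type_def by blast
  \<comment> \<open>The lower type constant carries no sign; enlarging it makes it positive and is
    harmless because \<phi> is nonnegative.\<close>
  interpret mo_lower_type M \<phi> p "max C0 1"
  proof
    show "\<phi> x (s * t) \<le> max C0 1 * s powr p * \<phi> x t" if "x \<in> space M" "0 \<le> t" "0 < s" "s < 1" for x t s
    proof -
      have "0 \<le> \<phi> x t" using assms(3) that unfolding MO_function_def by (metis order_refl)
      then have "C0 * s powr p * \<phi> x t \<le> max C0 1 * s powr p * \<phi> x t" by (intro mult_right_mono) auto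
      with C0[OF that] show ?thesis by simp
    qed
  qed (use assms in auto)
  interpret Mx: atomic_setting M F \<phi> p "max C0 1" qmax K R
    by unfold_locales (use K R S qmax_measurable in blast)+
  interpret Sq: atomic_setting M F \<phi> p "max C0 1" qsq K R
    by unfold_locales (use K R S qsq_measurable in blast)+
  show ?thesis
    unfolding maxf_eq sqf_eq
    using Mx.Hsp_eq_Hat[OF assms(8,9)] Sq.Hsp_eq_Hat[OF assms(8,9)] by blast
qed

end
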